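(* Let $\Omega\subset\mathbb{R}^2$ be a maximizer of the Gaussian perimeter among convex sets, i.e. $\Omega$ is convex and $P_{\gamma_2}(\Omega)\ge P_{\gamma_2}(D)$ for every convex set $D\subset\mathbb{R}^2$. Assume that there exist a point $P\in\partial\Omega$ and $\delta>0$ such that $B_{2\delta}(P)\cap\partial\Omega$ is a curve of class $C^2$. Then $B_{\delta}(P)\cap\partial\Omega$ is a straight line segment.
   Context: For a convex set $\Omega\subset\mathbb{R}^2$, its Gaussian perimeter is $P_{\gamma_2}(\Omega)=\frac{1}{2\pi}\int_{\partial\Omega}\exp\left(-\frac{|\mathbf{x}|^2}{2}\right)d\mathcal{H}^1(\mathbf{x})$, where $\mathcal{H}^1$ is the one-dimensional Hausdorff measure. $B_r(P)$ denotes the open disc of radius $r$ centered at $P$. *)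

theory Defs
  imports "HOL-Analysis.Analysis"
begin

text \<open>The delta-approximation of the one-dimensional Hausdorff outer measure
  (normalised so that H^1 of a segment is its length): infimum of the sums of
  diameters of countable covers by bounded sets of diameter at most delta.\<close>
definition hausdorff1_delta :: "real \<Rightarrow> 'a::metric_space set \<Rightarrow> ennreal" where
  "hausdorff1_delta d A =
     (INF C \<in> {C :: nat \<Rightarrow> 'a set. A \<subseteq> (\<Union>i. C i) \<and>
                  (\<forall>i. bounded (C i) \<and> diameter (C i) \<le> d)}.
        (\<Sum>i. ennreal (diameter (C i))))"

text \<open>One-dimensional Hausdorff outer measure: limit as delta goes to 0
  (the approximations increase as delta decreases, so the limit is the supremum).\<close>
definition hausdorff1_outer :: "'a::metric_space set \<Rightarrow> ennreal" where
  "hausdorff1_outer A = (SUP d \<in> {0<..}. hausdorff1_delta d A)"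

definition hausdorff1 :: "'a::euclidean_space measure" where
  "hausdorff1 = measure_of UNIV (sets borel) hausdorff1_outer"

definition gauss_perimeter :: "(real^2) set \<Rightarrow> ennreal" where
  "gauss_perimeter \<Omega> =
     ennreal (1 / (2 * pi)) *
     (\<integral>\<^sup>+ x \<in> frontier \<Omega>. ennreal (exp (- (norm x)\<^sup>2 / 2)) \<partial>hausdorff1)"

definition C2_curve :: "(real^2) set \<Rightarrow> bool" where
  "C2_curve S \<longleftrightarrow>
     (\<exists>(I::real set) (\<gamma>::real \<Rightarrow> real^2) \<gamma>' \<gamma>''.
        open I \<and> is_interval I \<and> I \<noteq> {} \<and>
        (\<forall>t\<in>I. (\<gamma> has_vector_derivative \<gamma>' t) (at t)) \<and>
        (\<forall>t\<in>I. (\<gamma>' has_vector_derivative \<gamma>'' t) (at t)) \<and>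
        continuous_on I \<gamma>'' \<and>
        (\<forall>t\<in>I. \<gamma>' t \<noteq> 0) \<and>
        \<gamma> ` I = S)"

end

theory Submission
  imports Defs
begin

text \<open>
  Near a boundary point of nonzero curvature the boundary is the graph of a function \<open>f\<close> with
  \<open>f'' \<ge> m > 0\<close> in a suitable orthonormal frame, and for a small \<open>C\<^sup>1\<close> bump \<open>u\<close> both \<open>f + u\<close> and
  \<open>f - u\<close> are still convex.  The Gaussian length of a graph has the integrand
  \<open>L(x, y, p) = exp (- (x\<^sup>2 + y\<^sup>2) / 2) * sqrt (1 + p\<^sup>2)\<close>, which is strictly convex in the slope \<open>p\<close>,
  so that the sum of the two perturbed lengths exceeds twice the original one by at least
  \<open>\<integral> (c * u'\<^sup>2 - C * u\<^sup>2)\<close>.  This is positive if the support of \<open>u\<close> is short, because \<open>u'\<close> then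
  dominates \<open>u\<close>.  Hence one of the two perturbations increases the perimeter, a contradiction
  (the perimeter of a convex set is finite).  So the curvature vanishes along the whole curve,
  which is therefore straight.
\<close>

section \<open>Hausdorff measure of dimension one\<close>

text \<open>Three obstacles shape the proof beyond the variational estimate. \<open>\<Omega>\<close>
  is not assumed closed or to have interior points, and its frontier may pass over the graph a
  second time, so the perturbed region is awkward to describe. The competitor is therefore the
  convex hull of the old frontier with one arc exchanged. If every point of the new curve has a
  supporting line, the curve lies in the frontier of the hull, and the perimeter of the hull is at
  least the Gaussian length of the curve. Supporting lines survive because \<open>u\<close> and
  \<open>u'\<close> vanish at both ends, so that the new arc keeps the end tangents. Next,
  cancelling the common part of both frontiers in \<open>ennreal\<close> requires finite measure;
  projecting circles onto the convex set bounds the length of its frontier in a disc linearly in the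
  radius, and the Gaussian weight makes the sum over annuli converge. Finally, the length of a graph
  has to be an integral although \<open>hausdorff1\<close> is defined by covers: covers bound a
  short arc from above, its chord bounds it from below, and so the measure is differentiable in the
  end point.\<close>

lemma hausdorff1_delta_antimono:
  assumes "d \<le> e" shows "hausdorff1_delta e A \<le> hausdorff1_delta d A"
  unfolding hausdorff1_delta_def using assms
  by (intro INF_superset_mono) (auto intro: order_trans)

lemma hausdorff1_delta_mono:
  assumes "A \<subseteq> B" shows "hausdorff1_delta d A \<le> hausdorff1_delta d B"
  unfolding hausdorff1_delta_def using assms
  by (intro INF_superset_mono) auto

lemma hausdorff1_delta_le_outer:
  assumes "d > 0" shows "hausdorff1_delta d A \<le> hausdorff1_outer A"
  unfolding hausdorff1_outer_def using assms by (intro SUP_upper) auto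

lemma hausdorff1_outer_mono:
  assumes "A \<subseteq> B" shows "hausdorff1_outer A \<le> hausdorff1_outer B"
  unfolding hausdorff1_outer_def
  by (intro SUP_mono) (use hausdorff1_delta_mono[OF assms] in blast)

lemma hausdorff1_delta_empty:
  assumes "d > 0" shows "hausdorff1_delta d {} = 0"
proof -
  have "hausdorff1_delta d {} \<le> (\<Sum>i. ennreal (diameter ({} :: 'a set)))"
    unfolding hausdorff1_delta_def using assms
    by (intro INF_lower2[of "\<lambda>_. {}"]) auto
  then show ?thesis by simp
qed

lemma hausdorff1_outer_empty: "hausdorff1_outer {} = 0"
  unfolding hausdorff1_outer_def by (auto simp: hausdorff1_delta_empty)

lemma hausdorff1_delta_UN_le:
  fixes A :: "nat \<Rightarrow> 'a::metric_space set"
  assumes "d > 0"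
  shows "hausdorff1_delta d (\<Union>i. A i) \<le> (\<Sum>n. hausdorff1_delta d (A n))"
proof (rule ennreal_le_epsilon)
  let ?O = "hausdorff1_delta d"
  fix e :: real assume "0 < e" "(\<Sum>n. ?O (A n)) < top"
  then have *: "\<And>n. ?O (A n) < ?O (A n) + e * (1/2)^Suc n"
    by (auto simp add: less_top dest!: ennreal_suminf_lessD)
  have "\<exists>C. A n \<subseteq> (\<Union>i. C i) \<and> (\<forall>i. bounded (C i) \<and> diameter (C i) \<le> d) \<and>
       (\<Sum>i. ennreal (diameter (C i))) \<le> ?O (A n) + e * (1/2)^Suc n" for n
    using *[of n] unfolding hausdorff1_delta_def[of d "A n"] INF_less_iff
    by (auto intro: less_imp_le)
  then obtain B where sbB: "\<And>n. A n \<subseteq> (\<Union>i. B n i)"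
    and B: "\<And>n i. bounded (B n i) \<and> diameter (B n i) \<le> d"
    and Ble: "\<And>n. (\<Sum>i. ennreal (diameter (B n i))) \<le> ?O (A n) + e * (1/2)^Suc n"
    by metis
  define C where "C = case_prod B o prod_decode"
  have A_C: "(\<Union>i. A i) \<subseteq> (\<Union>i. C i)"
    using sbB by (auto simp add: C_def subset_eq) (metis prod.case prod_encode_inverse)
  have "?O (\<Union>i. A i) \<le> (\<Sum>i. ennreal (diameter (C i)))"
    unfolding hausdorff1_delta_def using A_C B
    by (intro INF_lower2[of C]) (auto simp: C_def split_beta)
  also have "\<dots> = (\<Sum>n. \<Sum>i. ennreal (diameter (B n i)))"
    using suminf_ennreal_2dimen[of "\<lambda>n. \<Sum>i. ennreal (diameter (B n i))"
        "\<lambda>p. ennreal (diameter (case_prod B p))"]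
    by (simp add: C_def)
  also have "\<dots> \<le> (\<Sum>n. ?O (A n) + e * (1/2) ^ Suc n)"
    by (intro suminf_le allI Ble) auto
  also have "... = (\<Sum>n. ?O (A n)) + (\<Sum>n. ennreal e * ennreal ((1/2) ^ Suc n))"
    using \<open>0 < e\<close> by (subst suminf_add[symmetric])
                     (auto simp del: ennreal_suminf_cmult simp add: ennreal_mult[symmetric])
  also have "\<dots> = (\<Sum>n. ?O (A n)) + e"
    unfolding ennreal_suminf_cmult
    by (subst suminf_ennreal_eq[OF zero_le_power power_half_series]) auto
  finally show "?O (\<Union>i. A i) \<le> (\<Sum>n. ?O (A n)) + e" .
qed

lemma hausdorff1_outer_UN_le:
  fixes A :: "nat \<Rightarrow> 'a::metric_space set"
  shows "hausdorff1_outer (\<Union>i. A i) \<le> (\<Sum>n. hausdorff1_outer (A n))"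
  unfolding hausdorff1_outer_def[of "\<Union>i. A i"]
proof (rule SUP_least)
  fix d :: real assume "d \<in> {0<..}"
  then have "d > 0" by simp
  have "hausdorff1_delta d (\<Union>i. A i) \<le> (\<Sum>n. hausdorff1_delta d (A n))"
    by (rule hausdorff1_delta_UN_le) fact
  also have "\<dots> \<le> (\<Sum>n. hausdorff1_outer (A n))"
    using \<open>d > 0\<close> by (intro suminf_le allI hausdorff1_delta_le_outer) auto
  finally show "hausdorff1_delta d (\<Union>i. A i) \<le> (\<Sum>n. hausdorff1_outer (A n))" .
qed

lemma outer_measure_space_hausdorff1:
  "outer_measure_space UNIV hausdorff1_outer"
  by (auto simp: outer_measure_space_def positive_def hausdorff1_outer_empty increasing_def
      hausdorff1_outer_mono countably_subadditive_def hausdorff1_outer_UN_le)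

lemma hausdorff1_outer_Un_le:
  "hausdorff1_outer (A \<union> B) \<le> hausdorff1_outer A + hausdorff1_outer B"
proof -
  have sub: "subadditive UNIV (hausdorff1_outer :: 'a set \<Rightarrow> ennreal)"
    using outer_measure_space_hausdorff1[where 'a = 'a]
      ring_of_sets.countably_subadditive_subadditive[of UNIV "UNIV :: 'a set set" hausdorff1_outer]
      sigma_algebra_Pow[of "UNIV :: 'a set"]
    by (auto simp: outer_measure_space_def sigma_algebra_def algebra_def)
  \<comment> \<open>\<open>subadditive\<close> speaks of disjoint sets only.\<close>
  have "A \<union> B = A \<union> (B - A)" by auto
  then have "hausdorff1_outer (A \<union> B) \<le> hausdorff1_outer A + hausdorff1_outer (B - A)"
    using subadditiveD[OF sub, of A "B - A"] by simp
  also have "\<dots> \<le> hausdorff1_outer A + hausdorff1_outer B"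
    by (intro add_left_mono hausdorff1_outer_mono) auto
  finally show ?thesis .
qed

text \<open>A set of diameter at most \<open>d < r\<close> cannot meet both \<open>A\<close> and
  \<open>B\<close>, so each member of a cover of the union is charged to one of them only.\<close>

lemma hausdorff1_delta_separated:
  assumes "0 < d" "d < r" and sep: "\<And>x y. x \<in> A \<Longrightarrow> y \<in> B \<Longrightarrow> r \<le> dist x y"
  shows "hausdorff1_delta d A + hausdorff1_delta d B \<le> hausdorff1_delta d (A \<union> B)"
  unfolding hausdorff1_delta_def[of d "A \<union> B"]
proof (rule INF_greatest)
  fix C :: "nat \<Rightarrow> 'a set"
  assume "C \<in> {C. A \<union> B \<subseteq> (\<Union>i. C i) \<and> (\<forall>i. bounded (C i) \<and> diameter (C i) \<le> d)}"
  then have C: "A \<union> B \<subseteq> (\<Union>i. C i)" and bd: "\<And>i. bounded (C i)" and dm: "\<And>i. diameter (C i) \<le> d"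
    by auto
  have *: "hausdorff1_delta d X \<le> (\<Sum>i. ennreal (diameter (C i \<inter> X)))" if "X \<subseteq> A \<union> B" for X
    unfolding hausdorff1_delta_def
  proof (rule INF_lower2[of "\<lambda>i. C i \<inter> X"])
    have "diameter (C i \<inter> X) \<le> d" for i
      using diameter_subset[OF _ bd[of i], of "C i \<inter> X"] dm[of i] by auto
    then show "(\<lambda>i. C i \<inter> X) \<in> {C. X \<subseteq> (\<Union>i. C i) \<and> (\<forall>i. bounded (C i) \<and> diameter (C i) \<le> d)}"
      using C that bd by (auto intro: bounded_subset)
  qed auto
  have "hausdorff1_delta d A + hausdorff1_delta d B
      \<le> (\<Sum>i. ennreal (diameter (C i \<inter> A))) + (\<Sum>i. ennreal (diameter (C i \<inter> B)))"
    by (intro add_mono *) auto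
  also have "\<dots> = (\<Sum>i. ennreal (diameter (C i \<inter> A)) + ennreal (diameter (C i \<inter> B)))"
    by (rule suminf_add) auto
  also have "\<dots> \<le> (\<Sum>i. ennreal (diameter (C i)))"
  proof (intro suminf_le allI)
    fix i
    have "C i \<inter> A = {} \<or> C i \<inter> B = {}"
    proof (rule ccontr)
      assume "\<not> ?thesis"
      then obtain x y where "x \<in> C i" "x \<in> A" "y \<in> C i" "y \<in> B" by auto
      then have "dist x y \<le> d" using diameter_bounded_bound[OF bd] dm order_trans by blast
      with sep[OF \<open>x \<in> A\<close> \<open>y \<in> B\<close>] \<open>d < r\<close> show False by simp
    qed
    moreover have "ennreal (diameter (C i \<inter> X)) \<le> ennreal (diameter (C i))" for X
      by (intro ennreal_leI diameter_subset bd) auto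
    ultimately show "ennreal (diameter (C i \<inter> A)) + ennreal (diameter (C i \<inter> B)) \<le> ennreal (diameter (C i))"
      by auto
  qed auto
  finally show "hausdorff1_delta d A + hausdorff1_delta d B \<le> (\<Sum>i. ennreal (diameter (C i)))" .
qed

text \<open>The suprema defining the two summands run over unrelated scales. The approximations grow
  as the scale shrinks, so one scale that is below \<open>r\<close> and at most \<open>d\<close> and
  \<open>e\<close> serves both.\<close>

lemma hausdorff1_outer_separated:
  assumes "0 < r" and sep: "\<And>x y. x \<in> A \<Longrightarrow> y \<in> B \<Longrightarrow> r \<le> dist x y"
  shows "hausdorff1_outer A + hausdorff1_outer B \<le> hausdorff1_outer (A \<union> B)"
proof -
  have "hausdorff1_delta d A + hausdorff1_delta e B \<le> hausdorff1_outer (A \<union> B)"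
    if "d > 0" "e > 0" for d e
  proof -
    define m where "m = min (r/2) (min d e)"
    have m: "m > 0" "m < r" "m \<le> d" "m \<le> e" using that \<open>r > 0\<close> by (auto simp: m_def)
    have "hausdorff1_delta d A + hausdorff1_delta e B \<le> hausdorff1_delta m A + hausdorff1_delta m B"
      by (intro add_mono hausdorff1_delta_antimono m)
    also have "\<dots> \<le> hausdorff1_delta m (A \<union> B)"
      by (rule hausdorff1_delta_separated[OF m(1,2) sep])
    also have "\<dots> \<le> hausdorff1_outer (A \<union> B)"
      by (rule hausdorff1_delta_le_outer) fact
    finally show ?thesis .
  qed
  then have 1: "hausdorff1_outer A + hausdorff1_delta e B \<le> hausdorff1_outer (A \<union> B)" if "e > 0" for e
    using that unfolding hausdorff1_outer_def[of A]
    by (subst ennreal_SUP_add_left[symmetric]) (auto intro!: SUP_least)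
  show ?thesis unfolding hausdorff1_outer_def[of B]
    by (subst add.commute, subst ennreal_SUP_add_left[symmetric])
      (auto intro!: SUP_least simp: 1 add.commute)
qed

text \<open>This is the Caratheodory criterion for metric outer measures.
  \<open>A \<inter> C\<close> has positive distance from each \<open>B N\<close>, so these two
  measures add. The rest of \<open>A - C\<close> lies in the rings from index \<open>N\<close> on,
  whose measures form the tail of a convergent series.\<close>

lemma closed_hausdorff1_caratheodory:
  assumes "closed C"
  shows "hausdorff1_outer (A \<inter> C) + hausdorff1_outer (A - C) = hausdorff1_outer A"
proof (cases "C = {} \<or> hausdorff1_outer A = \<infinity>")
  case True
  have "hausdorff1_outer A \<le> hausdorff1_outer (A \<inter> C) + hausdorff1_outer (A - C)"
    using hausdorff1_outer_Un_le[of "A \<inter> C" "A - C"] by (simp add: Int_Diff_Un)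
  with True show ?thesis by (auto simp: hausdorff1_outer_empty neq_top_trans top_unique)
next
  case False
  let ?H = hausdorff1_outer
  have ne: "C \<noteq> {}" and fin: "?H A < \<infinity>" using False by (auto simp: less_top)
  \<comment> \<open>The rings \<open>R k\<close> around \<open>C\<close> of equal parity are mutually separated, so their measures are summable.\<close>
  define B where "B k = {x \<in> A. 1 / (real k + 1) \<le> infdist x C}" for k
  define R where "R k = {x \<in> A. 1 / (real k + 2) \<le> infdist x C \<and> infdist x C < 1 / (real k + 1)}" for k
  have gap: "b - a \<le> dist x y" if "infdist x C \<le> a" "b \<le> infdist y C" for x y a b
    using infdist_triangle[of y C x] that by (simp add: dist_commute)
  have parity: "(\<Sum>k<n. ?H (R (2 * k + j))) \<le> ?H (\<Union>k<n. R (2 * k + j))" for n j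
  proof (induction n)
    case (Suc n)
    show ?case
    \<comment> \<open>For \<open>n = 0\<close> the earlier union is empty, and with
      \<open>j = 0\<close> the separation constant used below would involve
      \<open>1 / 0 = 0\<close>.\<close>
    proof (cases "n = 0")
      case False
      have "(\<Sum>k<Suc n. ?H (R (2 * k + j))) \<le> ?H (\<Union>k<n. R (2 * k + j)) + ?H (R (2 * n + j))"
        using Suc by (simp add: add_right_mono)
      also have "\<dots> \<le> ?H ((\<Union>k<n. R (2 * k + j)) \<union> R (2 * n + j))"
      proof (rule hausdorff1_outer_separated[of "1 / (2 * real n + j) - 1 / (2 * real n + j + 1)"])
        show "0 < 1 / (2 * real n + real j) - 1 / (2 * real n + real j + 1)"
          using False by (intro diff_gt_0_iff_gt[THEN iffD2] divide_strict_left_mono mult_pos_pos) auto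
      next
        fix x y assume "x \<in> (\<Union>k<n. R (2 * k + j))" "y \<in> R (2 * n + j)"
        then obtain k where k: "k < n" and x: "x \<in> R (2 * k + j)" by auto
        have "1 / (2 * real n + real j) \<le> 1 / (real (2 * k + j) + 2)"
          using k by (intro divide_left_mono) auto
        with x have "1 / (2 * real n + real j) \<le> infdist x C" by (auto simp: R_def)
        with \<open>y \<in> R (2 * n + j)\<close> show "1 / (2 * real n + j) - 1 / (2 * real n + j + 1) \<le> dist x y"
          using gap[of y "1 / (2 * real n + j + 1)" "1 / (2 * real n + j)" x]
          by (auto simp: R_def dist_commute)
      qed
      also have "(\<Union>k<n. R (2 * k + j)) \<union> R (2 * n + j) = (\<Union>k<Suc n. R (2 * k + j))"
        by (auto simp: less_Suc_eq)
      finally show ?thesis .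
    qed (simp add: lessThan_Suc)
  qed simp
  have summ: "(\<Sum>k. ?H (R k)) \<noteq> \<infinity>"
  proof -
    have le: "(\<Sum>k. ?H (R (2 * k + j))) \<le> ?H A" for j
    proof (intro suminf_le_const[OF summableI])
      fix n
      have "(\<Union>k<n. R (2 * k + j)) \<subseteq> A" by (auto simp: R_def)
      from order_trans[OF parity hausdorff1_outer_mono[OF this]]
      show "(\<Sum>k<n. ?H (R (2 * k + j))) \<le> ?H A" .
    qed
    have "(\<Sum>k<n. ?H (R k)) \<le> ?H A + ?H A" for n
    proof -
      have "(\<Sum>k<n. ?H (R k)) \<le> (\<Sum>k<2 * n. ?H (R k))"
        by (intro sum_mono2) auto
      also have "\<dots> = (\<Sum>k<n. ?H (R (2 * k + 0))) + (\<Sum>k<n. ?H (R (2 * k + 1)))"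
        by (induction n) (auto simp: algebra_simps)
      also have "\<dots> \<le> ?H A + ?H A"
        using le[of 0] le[of 1] by (intro add_mono order_trans[OF sum_le_suminf[OF summableI]]) auto
      finally show ?thesis .
    qed
    then have "(\<Sum>k. ?H (R k)) \<le> ?H A + ?H A"
      by (intro suminf_le_const[OF summableI])
    with fin show ?thesis by (auto simp: top_unique)
  qed
  define r where "r k = enn2real (?H (R k))" for k
  have r: "?H (R k) = ennreal (r k)" "0 \<le> r k" for k
    using ennreal_suminf_lessD[of "\<lambda>k. ?H (R k)" \<infinity> k] summ
    by (auto simp: r_def less_top)
  have rsum: "summable r"
    using summ r by (intro summable_suminf_not_top) auto
  have "?H (A \<inter> C) + ?H (A - C) \<le> ?H A"
  proof (rule ennreal_le_epsilon)
    fix e :: real assume "e > 0"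
    obtain N where N: "\<And>n. n \<ge> N \<Longrightarrow> norm (\<Sum>i. r (i + n)) < e"
      using suminf_exist_split[OF \<open>e > 0\<close> rsum] by blast
    have tail: "(\<Sum>i. ?H (R (i + N))) \<le> ennreal e"
      using N[of N] r(2) summable_ignore_initial_segment[OF rsum, of N]
      by (simp add: r(1) suminf_ennreal2 ennreal_leI)
    have "A - C \<subseteq> B N \<union> (\<Union>i. R (i + N))"
    proof
      fix x assume x: "x \<in> A - C"
      then have pos: "infdist x C > 0"
        using assms ne in_closed_iff_infdist_zero[of C x] infdist_nonneg[of x C] by auto
      \<comment> \<open>If \<open>k\<close> is at least 2, then
        \<open>1 / k \<le> infdist x C < 1 / (k - 1)\<close>, so the ring containing
        \<open>x\<close> has index \<open>k - 2\<close>.\<close>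
      define k where "k = nat \<lceil>1 / infdist x C\<rceil>"
      have kpos: "k > 0" using pos by (simp add: k_def)
      have k1: "1 / infdist x C \<le> real k" and k2: "real k < 1 / infdist x C + 1"
        using pos by (auto simp: k_def) linarith+
      show "x \<in> B N \<union> (\<Union>i. R (i + N))"
      proof (cases "k \<le> N + 1")
        case True
        have "1 / (real N + 1) \<le> 1 / real k"
          using True kpos by (intro divide_left_mono) auto
        also have "\<dots> \<le> infdist x C"
          using k1 kpos pos by (simp add: field_simps)
        finally show ?thesis using x by (auto simp: B_def)
      next
        case False
        then obtain i where i: "k = i + N + 2" by (metis add.commute add.left_commute le_Suc_ex not_less_eq_eq add_2_eq_Suc' Suc_eq_plus1)
        have "1 / (real (i + N) + 2) \<le> infdist x C" "infdist x C < 1 / (real (i + N) + 1)"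
          using k1 k2 pos by (auto simp: i field_simps)
        then show ?thesis using x by (auto simp: R_def)
      qed
    qed
    then have "?H (A - C) \<le> ?H (B N \<union> (\<Union>i. R (i + N)))" by (rule hausdorff1_outer_mono)
    also have "\<dots> \<le> ?H (B N) + (\<Sum>i. ?H (R (i + N)))"
      by (rule order_trans[OF hausdorff1_outer_Un_le add_left_mono[OF hausdorff1_outer_UN_le]])
    also have "\<dots> \<le> ?H (B N) + e" by (intro add_left_mono tail)
    finally have "?H (A \<inter> C) + ?H (A - C) \<le> (?H (A \<inter> C) + ?H (B N)) + e"
      by (simp add: add.assoc add_left_mono)
    also have "?H (A \<inter> C) + ?H (B N) \<le> ?H ((A \<inter> C) \<union> B N)"
    proof (rule hausdorff1_outer_separated[of "1 / (real N + 1)"])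
      fix x y assume "x \<in> A \<inter> C" "y \<in> B N"
      then show "1 / (real N + 1) \<le> dist x y"
        using gap[of x 0 "1 / (real N + 1)" y] by (auto simp: B_def)
    qed auto
    also have "\<dots> \<le> ?H A" by (intro hausdorff1_outer_mono) (auto simp: B_def)
    finally show "?H (A \<inter> C) + ?H (A - C) \<le> ?H A + ennreal e"
      by (simp add: add_right_mono)
  qed
  moreover have "?H A \<le> ?H (A \<inter> C) + ?H (A - C)"
    using hausdorff1_outer_Un_le[of "A \<inter> C" "A - C"] by (simp add: Int_Diff_Un)
  ultimately show ?thesis by (rule antisym)
qed

text \<open>Without this, \<^const>\<open>hausdorff1\<close> would be the zero measure by the convention of
  \<^const>\<open>measure_of\<close>.\<close>

lemma measure_space_hausdorff1:
  "measure_space UNIV (sets borel) (hausdorff1_outer :: 'a::metric_space set \<Rightarrow> ennreal)"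
proof -
  interpret P: sigma_algebra UNIV "UNIV :: 'a set set"
    using sigma_algebra_Pow[of "UNIV :: 'a set"] by simp
  let ?L = "lambda_system UNIV UNIV (hausdorff1_outer :: 'a set \<Rightarrow> ennreal)"
  have L: "measure_space UNIV ?L hausdorff1_outer"
    by (rule P.caratheodory_lemma[OF outer_measure_space_hausdorff1])
  then interpret L: sigma_algebra UNIV ?L by (simp add: measure_space_def)
  have "Collect closed \<subseteq> ?L"
    using closed_hausdorff1_caratheodory
    by (auto simp: P.lambda_system_eq)
  then have "sets (borel :: 'a measure) \<subseteq> ?L"
    unfolding borel_eq_closed by (simp add: L.sigma_sets_subset)
  with L show ?thesis
    using sets.sigma_algebra_axioms[of "borel :: 'a measure"]
    by (auto simp: measure_space_def positive_def countably_additive_def subset_eq)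
qed

lemma sets_hausdorff1 [simp, measurable_cong]: "sets hausdorff1 = sets borel"
  unfolding hausdorff1_def using sets.sets_measure_of_eq[of borel] by (metis space_borel)

lemma emeasure_hausdorff1:
  "A \<in> sets borel \<Longrightarrow> emeasure hausdorff1 A = hausdorff1_outer A"
  unfolding hausdorff1_def using measure_space_hausdorff1[where 'a = 'a]
  by (intro emeasure_measure_of_sigma) (auto simp: measure_space_def)

section \<open>Arcs of class C1\<close>

lemma hausdorff1_outer_ge_dist:
  fixes S :: "'a::metric_space set"
  assumes "connected S" "a \<in> S" "b \<in> S"
  shows "ennreal (dist a b) \<le> hausdorff1_outer S"
proof -
  \<comment> \<open>The map \<open>dist a\<close> is 1-Lipschitz, and the image of \<open>S\<close> contains the interval from 0 to \<open>dist a b\<close>.\<close>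
  have "ennreal (dist a b) \<le> hausdorff1_delta 1 S"
    unfolding hausdorff1_delta_def
  proof (rule INF_greatest)
    fix C :: "nat \<Rightarrow> 'a set"
    assume "C \<in> {C. S \<subseteq> (\<Union>i. C i) \<and> (\<forall>i. bounded (C i) \<and> diameter (C i) \<le> 1)}"
    then have C: "S \<subseteq> (\<Union>i. C i)" and bd: "\<And>i. bounded (C i)" by auto
    \<comment> \<open>\<open>J i\<close> has the length of \<open>C i\<close> and contains its image
      under \<open>dist a\<close>. For empty \<open>C i\<close> it is a single point, of length
      0.\<close>
    define m where "m i = Inf (dist a ` C i)" for i
    define J where "J i = {m i..m i + diameter (C i)}" for i
    have J: "dist a x \<in> J i" if "x \<in> C i" for x i
    proof -
      have bb: "bdd_below (dist a ` C i)" by (intro bdd_belowI[of _ 0]) auto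
      have "m i \<le> dist a x" unfolding m_def using that by (intro cInf_lower bb) auto
      moreover have "dist a x - diameter (C i) \<le> m i" unfolding m_def
      proof (rule cInf_greatest)
        fix z assume "z \<in> dist a ` C i"
        then obtain y where y: "y \<in> C i" "z = dist a y" by auto
        have "dist x y \<le> diameter (C i)" using diameter_bounded_bound[OF bd that y(1)] .
        with dist_triangle[of a x y] y show "dist a x - diameter (C i) \<le> z"
          by (simp add: dist_commute)
      qed (use that in auto)
      ultimately show ?thesis by (auto simp: J_def)
    qed
    have "{0..dist a b} \<subseteq> dist a ` S"
    proof
      fix t assume t: "t \<in> {0..dist a b}"
      have "connected (dist a ` S)"
        by (intro connected_continuous_image assms continuous_intros)
      then have "is_interval (dist a ` S)" by (simp add: is_interval_connected_1)
      moreover have "0 \<in> dist a ` S" "dist a b \<in> dist a ` S"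
        using assms by (auto intro: image_eqI[of _ _ a])
      ultimately show "t \<in> dist a ` S" using t by (meson atLeastAtMost_iff mem_is_interval_1_I)
    qed
    also have "\<dots> \<subseteq> (\<Union>i. J i)" using C J by blast
    finally have "emeasure lborel {0..dist a b} \<le> emeasure lborel (\<Union>i. J i)"
      by (intro emeasure_mono) (auto simp: J_def)
    also have "\<dots> \<le> (\<Sum>i. emeasure lborel (J i))"
      by (intro emeasure_subadditive_countably) (auto simp: J_def)
    also have "\<dots> = (\<Sum>i. ennreal (diameter (C i)))"
      using diameter_ge_0[OF bd] by (simp add: J_def)
    finally show "ennreal (dist a b) \<le> (\<Sum>i. ennreal (diameter (C i)))" by simp
  qed
  also have "\<dots> \<le> hausdorff1_outer S" by (rule hausdorff1_delta_le_outer) simp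
  finally show ?thesis .
qed

text \<open>Cutting the interval into \<open>N\<close> equal pieces gives images of diameter at most
  \<open>M * h\<close>. Their sum is at most \<open>M * (d - c)\<close> for every \<open>N\<close>,
  and large \<open>N\<close> makes the pieces admissible at scale \<open>\<delta>\<close>.\<close>

lemma hausdorff1_outer_lipschitz_image_le:
  fixes f :: "real \<Rightarrow> 'a::real_normed_vector"
  assumes "c \<le> d" "0 \<le> M"
    and lip: "\<And>s t. \<lbrakk>s \<in> {c..d}; t \<in> {c..d}\<rbrakk> \<Longrightarrow> norm (f s - f t) \<le> M * \<bar>s - t\<bar>"
  shows "hausdorff1_outer (f ` {c..d}) \<le> ennreal (M * (d - c))"
  unfolding hausdorff1_outer_def
proof (rule SUP_least)
  fix \<delta> :: real assume "\<delta> \<in> {0<..}"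
  then have "\<delta> > 0" by simp
  obtain N :: nat where N: "N > 0" "M * (d - c) / \<delta> < N"
  proof -
    obtain N :: nat where N: "M * (d - c) / \<delta> < N" using reals_Archimedean2 by blast
    moreover have "0 \<le> M * (d - c) / \<delta>" using assms \<open>\<delta> > 0\<close> by simp
    ultimately have "N > 0" by (metis gr_zeroI not_less of_nat_0)
    with N that show thesis by blast
  qed
  define h where "h = (d - c) / N"
  have h: "0 \<le> h" "N * h = d - c" using assms N by (auto simp: h_def)
  have Mh: "M * h \<le> \<delta>" using N \<open>\<delta> > 0\<close> by (simp add: h_def field_simps)
  define C where "C i = (if i < N then f ` {c + real i * h..c + (real i + 1) * h} else {})" for i :: nat
  have sub: "{c + real i * h..c + (real i + 1) * h} \<subseteq> {c..d}" if "i < N" for i :: nat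
  proof -
    have "(real i + 1) * h \<le> N * h" using that h by (intro mult_right_mono) auto
    with h show ?thesis by (auto simp: algebra_simps)
  qed
  have lipC: "norm (x - y) \<le> M * h" if xy: "x \<in> C i" "y \<in> C i" for x y i
  proof (cases "i < N")
    case True
    then obtain s t where st: "s \<in> {c + real i * h..c + (real i + 1) * h}" "t \<in> {c + real i * h..c + (real i + 1) * h}"
        "x = f s" "y = f t"
      using xy unfolding C_def if_P[OF True] by blast
    have "norm (x - y) \<le> M * \<bar>s - t\<bar>" using lip sub[OF True] st by blast
    also have "\<dots> \<le> M * h"
      using st by (intro mult_left_mono \<open>0 \<le> M\<close>) (auto simp: algebra_simps abs_le_iff)
    finally show ?thesis .
  qed (use xy in \<open>auto simp: C_def\<close>)
  have bd: "bounded (C i)" for i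
    unfolding bounded_two_points using lipC[of _ i] by (auto simp: dist_norm)
  have dm: "diameter (C i) \<le> M * h" for i
    using lipC[of _ i] assms h by (intro diameter_le) auto
  have cov: "f ` {c..d} \<subseteq> (\<Union>i. C i)"
  proof
    fix x assume "x \<in> f ` {c..d}"
    then obtain t where t: "t \<in> {c..d}" "x = f t" by auto
    show "x \<in> (\<Union>i. C i)"
    \<comment> \<open>The right end would receive index \<open>N\<close>, so it is assigned to the
      last piece. This also disposes of \<open>c = d\<close>, where \<open>h = 0\<close>.\<close>
    proof (cases "t = d")
      case True
      then have "t \<in> {c + real (N - 1) * h..c + (real (N - 1) + 1) * h}"
        using h N t by (auto simp: algebra_simps of_nat_diff)
      then show ?thesis using t N by (auto simp: C_def intro!: exI[of _ "N - 1"])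
    next
      case False
      then have "h > 0" using t h N by (auto simp: h_def)
      define i where "i = nat \<lfloor>(t - c) / h\<rfloor>"
      have i: "real i \<le> (t - c) / h" "(t - c) / h < real i + 1"
        using t \<open>h > 0\<close> by (auto simp: i_def)
      then have i': "i * h \<le> t - c" "t - c < (i + 1) * h"
        using \<open>h > 0\<close> by (auto simp: field_simps)
      have "i * h < N * h" using i' False t h by auto
      then have "i < N" using \<open>h > 0\<close> by simp
      moreover have "t \<in> {c + real i * h..c + (real i + 1) * h}" using i' by (simp add: algebra_simps)
      ultimately show ?thesis using t(2) by (auto simp: C_def intro!: exI[of _ i])
    qed
  qed
  have "hausdorff1_delta \<delta> (f ` {c..d}) \<le> (\<Sum>i. ennreal (diameter (C i)))"
    unfolding hausdorff1_delta_def using cov bd order_trans[OF dm Mh]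
    by (intro INF_lower2[of C]) auto
  also have "\<dots> = (\<Sum>i<N. ennreal (diameter (C i)))"
    by (intro suminf_finite) (auto simp: C_def)
  also have "\<dots> \<le> (\<Sum>i<N. ennreal (M * h))"
    by (intro sum_mono ennreal_leI dm)
  also have "\<dots> = ennreal (M * (d - c))"
    using h assms by (simp add: ennreal_of_nat_eq_real_of_nat ennreal_mult[symmetric] mult.left_commute flip: h(2))
  finally show "hausdorff1_delta \<delta> (f ` {c..d}) \<le> ennreal (M * (d - c))" .
qed

lemma emeasure_density_bounds:
  assumes "w \<in> borel_measurable M" "A \<in> sets M"
  shows "(\<And>x. x \<in> A \<Longrightarrow> w x \<le> k) \<Longrightarrow> emeasure (density M w) A \<le> k * emeasure M A"
    and "(\<And>x. x \<in> A \<Longrightarrow> k \<le> w x) \<Longrightarrow> k * emeasure M A \<le> emeasure (density M w) A"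
  using assms
  by (auto simp: emeasure_density nn_integral_cmult_indicator[symmetric] intro!: nn_integral_mono
      split: split_indicator)

lemma arc_weighted_hausdorff1:
  fixes G :: "real \<Rightarrow> 'a::euclidean_space" and w :: "'a \<Rightarrow> real"
  assumes w: "continuous_on UNIV w" "\<And>x. 0 < w x"
    and "a \<le> b" and inj: "inj_on G {a..b}"
    and der: "\<And>t. t \<in> {a..b} \<Longrightarrow> (G has_vector_derivative G' t) (at t within {a..b})"
    and cont: "continuous_on {a..b} G'"
  defines "\<mu> \<equiv> density hausdorff1 (\<lambda>x. ennreal (w x))"
  shows "emeasure \<mu> (G ` {a..b}) < \<infinity>"
    and "((\<lambda>t. w (G t) * norm (G' t)) has_integral measure \<mu> (G ` {a..b})) {a..b}"
proof -
  have wm: "(\<lambda>x. ennreal (w x)) \<in> borel_measurable hausdorff1"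
    using borel_measurable_continuous_onI[OF w(1)] by (simp cong: measurable_cong_sets)
  have contG: "continuous_on {a..b} G"
    using der by (rule continuous_on_vector_derivative)
  have arc: "compact (G ` {s..t})" "connected (G ` {s..t})" if "s \<in> {a..b}" "t \<in> {a..b}" for s t
    using that by (auto intro!: compact_continuous_image connected_continuous_image
        continuous_on_subset[OF contG])
  have arcb: "G ` {s..t} \<in> sets borel" if "s \<in> {a..b}" "t \<in> {a..b}" for s t
    using arc(1)[OF that] by (intro borel_closed compact_imp_closed)
  have lin: "norm (G t - G s - (t - s) *\<^sub>R G' x) \<le> \<eta> * \<bar>t - s\<bar>"
    if "s \<in> {c..d}" "t \<in> {c..d}" "x \<in> {c..d}" "{c..d} \<subseteq> {a..b}" 
      and "\<And>y. y \<in> {c..d} \<Longrightarrow> norm (G' y - G' x) \<le> \<eta>" for s t x c d \<eta>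
  proof -
    have "norm (G t - G s - (t - s) *\<^sub>R G' x) \<le> norm (t - s) * \<eta>"
      using that
      by (intro vector_differentiable_bound_linearization[where S = "{c..d}" and f' = G'])
        (auto intro!: has_vector_derivative_within_subset[OF der] simp: closed_segment_eq_real_ivl split: if_splits)
    then show ?thesis by (simp add: mult.commute)
  qed
  have upper: "emeasure \<mu> (G ` {c..d}) \<le> ennreal (k * ((norm (G' x) + \<eta>) * (d - c)))"
    if cd: "c \<le> d" "x \<in> {c..d}" "{c..d} \<subseteq> {a..b}" "0 \<le> k" "0 \<le> \<eta>"
      and 1: "\<And>y. y \<in> {c..d} \<Longrightarrow> norm (G' y - G' x) \<le> \<eta>"
      and 2: "\<And>y. y \<in> {c..d} \<Longrightarrow> w (G y) \<le> k" for c d x k \<eta>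
  proof -
    have "hausdorff1_outer (G ` {c..d}) \<le> ennreal ((norm (G' x) + \<eta>) * (d - c))"
    proof (rule hausdorff1_outer_lipschitz_image_le)
      fix s t assume st: "s \<in> {c..d}" "t \<in> {c..d}"
      have "norm (G s - G t) \<le> norm (G s - G t - (s - t) *\<^sub>R G' x) + norm ((s - t) *\<^sub>R G' x)"
        using norm_triangle_ineq[of "G s - G t - (s - t) *\<^sub>R G' x" "(s - t) *\<^sub>R G' x"] by simp
      also have "\<dots> \<le> (norm (G' x) + \<eta>) * \<bar>s - t\<bar>"
        using lin[OF st(2,1) cd(2,3) 1] by (simp add: distrib_left mult.commute)
      finally show "norm (G s - G t) \<le> (norm (G' x) + \<eta>) * \<bar>s - t\<bar>" .
    qed (use cd in auto)
    then have "emeasure hausdorff1 (G ` {c..d}) \<le> ennreal ((norm (G' x) + \<eta>) * (d - c))"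
      using arcb[of c d] cd by (simp add: emeasure_hausdorff1)
    then have "ennreal k * emeasure hausdorff1 (G ` {c..d})
        \<le> ennreal k * ennreal ((norm (G' x) + \<eta>) * (d - c))"
      by (rule mult_left_mono) simp
    moreover have "emeasure \<mu> (G ` {c..d}) \<le> ennreal k * emeasure hausdorff1 (G ` {c..d})"
      unfolding \<mu>_def using wm arcb[of c d] cd 2
      by (intro emeasure_density_bounds) (auto intro!: ennreal_leI)
    ultimately show ?thesis
      using cd by (simp add: ennreal_mult[symmetric])
  qed
  have lower: "ennreal (k * ((norm (G' x) - \<eta>) * (d - c))) \<le> emeasure \<mu> (G ` {c..d})"
    if cd: "c \<le> d" "x \<in> {c..d}" "{c..d} \<subseteq> {a..b}" "0 \<le> k" "0 \<le> \<eta>"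
      and 1: "\<And>y. y \<in> {c..d} \<Longrightarrow> norm (G' y - G' x) \<le> \<eta>"
      and 2: "\<And>y. y \<in> {c..d} \<Longrightarrow> k \<le> w (G y)" for c d x k \<eta>
  proof -
    have "norm ((d - c) *\<^sub>R G' x) \<le> norm (G d - G c) + norm (G d - G c - (d - c) *\<^sub>R G' x)"
      using norm_triangle_sub[of "(d - c) *\<^sub>R G' x" "G d - G c"]
        norm_minus_commute[of "(d - c) *\<^sub>R G' x" "G d - G c"] by argo
    moreover have "norm (G d - G c - (d - c) *\<^sub>R G' x) \<le> \<eta> * (d - c)"
      using lin[OF _ _ cd(2,3) 1, of c d] cd(1) by simp
    moreover have "norm ((d - c) *\<^sub>R G' x) = norm (G' x) * (d - c)"
      using cd(1) by simp
    ultimately have "(norm (G' x) - \<eta>) * (d - c) \<le> dist (G c) (G d)"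
      unfolding left_diff_distrib dist_norm norm_minus_commute[of "G c" "G d"] by linarith
    then have "ennreal ((norm (G' x) - \<eta>) * (d - c)) \<le> ennreal (dist (G c) (G d))"
      by (rule ennreal_leI)
    also have "\<dots> \<le> hausdorff1_outer (G ` {c..d})"
      using arc(2)[of c d] cd by (intro hausdorff1_outer_ge_dist) auto
    also have "\<dots> = emeasure hausdorff1 (G ` {c..d})"
      using arcb[of c d] cd by (simp add: emeasure_hausdorff1)
    finally have "ennreal k * ennreal ((norm (G' x) - \<eta>) * (d - c))
        \<le> ennreal k * emeasure hausdorff1 (G ` {c..d})"
      by (rule mult_left_mono) simp
    also have "\<dots> \<le> emeasure \<mu> (G ` {c..d})"
      unfolding \<mu>_def using wm arcb[of c d] cd 2
      by (intro emeasure_density_bounds) (auto intro!: ennreal_leI)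
    \<comment> \<open>When \<open>norm (G' x) < \<eta>\<close> the left-hand side is
      \<open>ennreal\<close> of a nonpositive number, that is 0.\<close>
    finally show ?thesis
      using cd by (cases "0 \<le> (norm (G' x) - \<eta>) * (d - c)")
        (auto simp: ennreal_mult[symmetric] ennreal_neg mult_nonneg_nonpos)
  qed
  have contw: "continuous_on {a..b} (\<lambda>t. w (G t))"
    by (rule continuous_on_compose2[OF w(1) contG]) auto
  show fin: "emeasure \<mu> (G ` {a..b}) < \<infinity>"
  proof -
    obtain k where k: "\<And>y. y \<in> {a..b} \<Longrightarrow> w (G y) \<le> k"
      using compact_continuous_image[OF contw, THEN compact_imp_bounded]
      by (force simp: bounded_iff abs_le_iff)
    obtain \<eta> where \<eta>: "\<And>y. y \<in> {a..b} \<Longrightarrow> norm (G' y - G' a) \<le> \<eta>"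
      using compact_continuous_image[OF continuous_on_diff[OF cont continuous_on_const[of _ "G' a"]],
          THEN compact_imp_bounded] by (force simp: bounded_iff)
    have "0 \<le> k" "0 \<le> \<eta>"
      using k[of a] w(2)[of "G a"] \<eta>[of a] \<open>a \<le> b\<close> by auto
    then have "emeasure \<mu> (G ` {a..b}) \<le> ennreal (k * ((norm (G' a) + \<eta>) * (b - a)))"
      using k \<eta> \<open>a \<le> b\<close> by (intro upper) auto
    then show ?thesis by (auto intro: le_less_trans)
  qed
  show "((\<lambda>t. w (G t) * norm (G' t)) has_integral measure \<mu> (G ` {a..b})) {a..b}"
  proof -
    define F where "F t = measure \<mu> (G ` {a..t})" for t
    have fm: "G ` {s..t} \<in> fmeasurable \<mu>" if "s \<in> {a..b}" "t \<in> {a..b}" for s t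
    proof (rule fmeasurableI)
      show "G ` {s..t} \<in> sets \<mu>" using arcb[OF that] by (simp add: \<mu>_def)
      have "emeasure \<mu> (G ` {s..t}) \<le> emeasure \<mu> (G ` {a..b})"
        using that arcb[of a b] \<open>a \<le> b\<close> by (intro emeasure_mono) (auto simp: \<mu>_def)
      with fin show "emeasure \<mu> (G ` {s..t}) < \<infinity>" by (rule le_less_trans[rotated])
    qed
    \<comment> \<open>Injectivity makes consecutive arcs meet in one point only; since points are
      null, the increments of \<open>F\<close> are the measures of the subarcs.\<close>
    have pt: "measure \<mu> {G s} = 0" if "s \<in> {a..b}" for s
      using upper[of s s s "w (G s)" 0] that w(2)[of "G s"] by (simp add: measure_def)
    have diff: "F t - F s = measure \<mu> (G ` {s..t})" if "s \<in> {a..b}" "t \<in> {a..b}" "s \<le> t" for s t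
    proof -
      have "G ` {a..t} = G ` {a..s} \<union> G ` {s..t}"
        using that by (auto simp flip: image_Un simp: ivl_disj_un)
      moreover have "G ` {a..s} \<inter> G ` {s..t} = {G s}"
        using that inj_on_image_Int[OF inj, of "{a..s}" "{s..t}"] by (auto simp: Int_atLeastAtMost)
      ultimately show ?thesis
        using measure_Un3[OF fm[of a s] fm[of s t]] that pt[of s] \<open>a \<le> b\<close> by (simp add: F_def)
    qed
    \<comment> \<open>The interval contains \<open>x\<close> but need not start or end there, so one
      estimate serves the left and the right difference quotient.\<close>
    have est: "\<exists>r>0. \<forall>s t. s \<in> {a..b} \<and> t \<in> {a..b} \<and> s \<le> x \<and> x \<le> t \<and> x - s < r \<and> t - x < r \<longrightarrow>
        \<bar>measure \<mu> (G ` {s..t}) - w (G x) * norm (G' x) * (t - s)\<bar> \<le> e * (t - s)"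
      if x: "x \<in> {a..b}" and "e > 0" for x e
    proof -
      define W V where "W = w (G x)" and "V = norm (G' x)"
      have WV: "0 < W" "0 \<le> V" using w(2) by (auto simp: W_def V_def)
      \<comment> \<open>With \<open>\<eta> \<le> 1\<close>, the error of
        \<open>(W + \<eta>) * (V + \<eta>)\<close> against \<open>W * V\<close> is at most
        \<open>\<eta> * (W + V + 1)\<close>, hence at most \<open>e\<close>. The bound
        \<open>\<eta> \<le> W\<close> keeps the factor \<open>W - \<eta>\<close> in
        \<open>lower\<close> nonnegative.\<close>
      define \<eta> where "\<eta> = min (min 1 W) (e / (W + V + 1))"
      have "\<eta> \<le> e / (W + V + 1)" by (simp add: \<eta>_def)
      then have "\<eta> * (W + V + 1) \<le> e" using WV by (simp add: pos_le_divide_eq)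
      then have \<eta>: "0 < \<eta>" "\<eta> \<le> 1" "\<eta> \<le> W" "\<eta> * (W + V + 1) \<le> e"
        using WV \<open>e > 0\<close> by (simp_all add: \<eta>_def)
      obtain r1 where r1: "r1 > 0" "\<And>y. y \<in> {a..b} \<Longrightarrow> dist y x < r1 \<Longrightarrow> dist (G' y) (G' x) < \<eta>"
        using cont x \<eta>(1) unfolding continuous_on_iff by metis
      obtain r2 where r2: "r2 > 0" "\<And>y. y \<in> {a..b} \<Longrightarrow> dist y x < r2 \<Longrightarrow> dist (w (G y)) W < \<eta>"
        using contw x \<eta>(1) unfolding continuous_on_iff W_def by metis
      show ?thesis
      proof (intro exI[of _ "min r1 r2"] conjI allI impI)
        fix s t assume st: "s \<in> {a..b} \<and> t \<in> {a..b} \<and> s \<le> x \<and> x \<le> t \<and> x - s < min r1 r2 \<and> t - x < min r1 r2"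
        have near: "norm (G' y - G' x) \<le> \<eta>" "w (G y) \<le> W + \<eta>" "W - \<eta> \<le> w (G y)" if "y \<in> {s..t}" for y
        proof -
          have y: "y \<in> {a..b}" "dist y x < r1" "dist y x < r2"
            using that st by (auto simp: dist_real_def)
          show "norm (G' y - G' x) \<le> \<eta>" "w (G y) \<le> W + \<eta>" "W - \<eta> \<le> w (G y)"
            using r1(2)[OF y(1,2)] r2(2)[OF y(1,3)] by (auto simp: dist_norm abs_le_iff)
        qed
        have em: "emeasure \<mu> (G ` {s..t}) = ennreal (measure \<mu> (G ` {s..t}))"
          using fm[of s t] st by (auto simp: emeasure_eq_measure2)
        have "measure \<mu> (G ` {s..t}) \<le> (W + \<eta>) * ((V + \<eta>) * (t - s))"
          using upper[of s t x "W + \<eta>" \<eta>] near st WV \<eta> by (simp add: em V_def)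
        moreover have "(W - \<eta>) * ((V - \<eta>) * (t - s)) \<le> measure \<mu> (G ` {s..t})"
          using lower[of s t x "W - \<eta>" \<eta>] near st WV \<eta> by (simp add: em V_def)
        moreover have "(W + \<eta>) * ((V + \<eta>) * (t - s)) \<le> (W * V + e) * (t - s)"
        proof -
          have "\<eta> * \<eta> \<le> \<eta>" using mult_left_mono[of \<eta> 1 \<eta>] \<eta> by simp
          moreover have "(W + \<eta>) * (V + \<eta>) = W * V + \<eta> * (W + V + 1) + (\<eta> * \<eta> - \<eta>)"
            by (simp add: algebra_simps)
          ultimately have "(W + \<eta>) * (V + \<eta>) \<le> W * V + e" using \<eta>(4) by linarith
          then have "(W + \<eta>) * (V + \<eta>) * (t - s) \<le> (W * V + e) * (t - s)"
            using st by (intro mult_right_mono) auto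
          then show ?thesis by (simp add: mult.assoc)
        qed
        moreover have "(W * V - e) * (t - s) \<le> (W - \<eta>) * ((V - \<eta>) * (t - s))"
        proof -
          have "W * V - e \<le> (W - \<eta>) * (V - \<eta>)"
          proof -
            have "(W - \<eta>) * (V - \<eta>) = W * V - \<eta> * (W + V + 1) + (\<eta> * \<eta> + \<eta>)"
              by (simp add: algebra_simps)
            then show ?thesis using \<eta> mult_nonneg_nonneg[of \<eta> \<eta>] by linarith
          qed
          then have "(W * V - e) * (t - s) \<le> (W - \<eta>) * (V - \<eta>) * (t - s)"
            using st by (intro mult_right_mono) auto
          then show ?thesis by (simp add: mult.assoc)
        qed
        ultimately show "\<bar>measure \<mu> (G ` {s..t}) - w (G x) * norm (G' x) * (t - s)\<bar> \<le> e * (t - s)"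
          unfolding W_def[symmetric] V_def[symmetric] by (simp add: abs_le_iff algebra_simps)
      qed (use r1 r2 in auto)
    qed
    have "(F has_vector_derivative w (G x) * norm (G' x)) (at x within {a..b})" if x: "x \<in> {a..b}" for x
      unfolding has_vector_derivative_def has_derivative_within_alt
    proof (intro conjI allI impI)
      show "bounded_linear (\<lambda>h. h *\<^sub>R (w (G x) * norm (G' x)))"
        by (rule bounded_linear_scaleR_left)
      fix e :: real assume "e > 0"
      from est[OF x this] obtain r where r: "r > 0" and
        *: "\<And>s t. \<lbrakk>s \<in> {a..b}; t \<in> {a..b}; s \<le> x; x \<le> t; x - s < r; t - x < r\<rbrakk> \<Longrightarrow>
           \<bar>measure \<mu> (G ` {s..t}) - w (G x) * norm (G' x) * (t - s)\<bar> \<le> e * (t - s)"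
        by blast
      show "\<exists>r>0. \<forall>y\<in>{a..b}. norm (y - x) < r \<longrightarrow>
          norm (F y - F x - (y - x) *\<^sub>R (w (G x) * norm (G' x))) \<le> e * norm (y - x)"
      proof (intro exI[of _ r] conjI ballI impI)
        fix y assume y: "y \<in> {a..b}" "norm (y - x) < r"
        show "norm (F y - F x - (y - x) *\<^sub>R (w (G x) * norm (G' x))) \<le> e * norm (y - x)"
        proof (cases "x \<le> y")
          case True
          then show ?thesis using *[of x y] diff[of x y] x y r by (simp add: mult.commute)
        next
          case False
          then show ?thesis using *[of y x] diff[of y x] x y r
            by (simp add: abs_minus_commute algebra_simps)
        qed
      qed (rule r)
    qed
    then have "((\<lambda>t. w (G t) * norm (G' t)) has_integral F b - F a) {a..b}"
      by (rule fundamental_theorem_of_calculus[OF \<open>a \<le> b\<close>])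
    moreover have "F a = 0" using pt[of a] \<open>a \<le> b\<close> by (simp add: F_def)
    ultimately show ?thesis by (simp add: F_def)
  qed
qed

section \<open>Finiteness of the Gaussian perimeter of convex sets\<close>

text \<open>The Gaussian perimeter without its factor, kept as a measure so that exchanging an arc
  of the frontier becomes a matter of additivity.\<close>

definition gauss_h1 :: "(real^2) measure" where
  "gauss_h1 = density hausdorff1 (\<lambda>x. ennreal (exp (- (norm x)\<^sup>2 / 2)))"

lemma measurable_gauss_weight:
  "(\<lambda>x :: real^2. ennreal (exp (- (norm x)\<^sup>2 / 2))) \<in> borel_measurable hausdorff1"
proof -
  have "continuous_on UNIV (\<lambda>x :: real^2. exp (- (norm x)\<^sup>2 / 2))" by (intro continuous_intros) auto
  from borel_measurable_continuous_onI[OF this] show ?thesis by (simp cong: measurable_cong_sets)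
qed

lemma sets_gauss_h1 [simp, measurable_cong]: "sets gauss_h1 = sets borel"
  by (simp add: gauss_h1_def)

lemma gauss_perimeter_eq:
  "gauss_perimeter \<Omega> = ennreal (1 / (2 * pi)) * emeasure gauss_h1 (frontier \<Omega>)"
  unfolding gauss_perimeter_def gauss_h1_def
  by (subst emeasure_density[OF measurable_gauss_weight]) (auto intro: borel_closed)

text \<open>If the interior is empty, \<open>x\<close> may well lie in the relative interior, but
  then \<open>S\<close> sits in a hyperplane, whose normal supports it everywhere. Otherwise
  frontier and relative frontier agree.\<close>

lemma supporting_hyperplane_frontier:
  fixes S :: "'a::euclidean_space set"
  assumes "convex S" "x \<in> frontier S"
  obtains v where "v \<noteq> 0" "\<And>y. y \<in> closure S \<Longrightarrow> v \<bullet> x \<le> v \<bullet> y"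
proof (cases "interior S = {}")
  case True
  then obtain a b where ab: "a \<noteq> 0" "S \<subseteq> {x. a \<bullet> x = b}"
    using empty_interior_subset_hyperplane[OF assms(1)] by blast
  then have "closure S \<subseteq> {x. a \<bullet> x = b}"
    by (intro closure_minimal closed_hyperplane)
  moreover have "x \<in> closure S" using assms(2) by (simp add: frontier_def)
  ultimately have "a \<bullet> x = b" "\<And>y. y \<in> closure S \<Longrightarrow> a \<bullet> y = b" by blast+
  then have "a \<bullet> x \<le> a \<bullet> y" if "y \<in> closure S" for y using that by simp
  with that[OF ab(1)] show ?thesis by blast
next
  case False
  then have "x \<notin> rel_interior S" "x \<in> closure S"
    using assms(2) by (auto simp: rel_interior_nonempty_interior frontier_def)
  from supporting_hyperplane_relative_frontier[OF assms(1) this(2,1)] that show ?thesis by metis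
qed

text \<open>The direction \<open>- v\<close> is an outer normal at \<open>q\<close>: since
  \<open>v \<bullet> (z - q)\<close> is nonnegative on \<open>S\<close>, adding \<open>z - q\<close>
  to \<open>s *\<^sub>R v\<close> cannot shorten it.\<close>

lemma closest_point_normal:
  assumes "convex S" "closed S" "q \<in> S" "0 \<le> s" and v: "\<And>y. y \<in> S \<Longrightarrow> v \<bullet> q \<le> v \<bullet> y"
  shows "closest_point S (q - s *\<^sub>R v) = q"
proof (rule closest_point_unique[symmetric])
  show "\<forall>z\<in>S. dist (q - s *\<^sub>R v) q \<le> dist (q - s *\<^sub>R v) z"
  proof
    fix z assume "z \<in> S"
    then have "0 \<le> (s *\<^sub>R v) \<bullet> (z - q)"
      using v[of z] assms(4) by (simp add: inner_diff_right mult_left_mono)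
    moreover have "(norm (s *\<^sub>R v + (z - q)))\<^sup>2
        = (norm (s *\<^sub>R v))\<^sup>2 + 2 * ((s *\<^sub>R v) \<bullet> (z - q)) + (norm (z - q))\<^sup>2"
      unfolding power2_norm_eq_inner by (simp add: inner_add_left inner_add_right inner_commute)
    ultimately have "(norm (s *\<^sub>R v))\<^sup>2 \<le> (norm (s *\<^sub>R v + (z - q)))\<^sup>2"
      by simp
    then have "norm (s *\<^sub>R v) \<le> norm (s *\<^sub>R v + (z - q))" by (rule power2_le_imp_le) simp
    moreover have "dist (q - s *\<^sub>R v) z = norm (s *\<^sub>R v + (z - q))"
      by (simp add: dist_norm norm_minus_commute algebra_simps flip: norm_minus_cancel[of "s *\<^sub>R v + (z - q)"])
    ultimately show "dist (q - s *\<^sub>R v) q \<le> dist (q - s *\<^sub>R v) z"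
      by (simp add: dist_norm)
  qed
qed (use assms in auto)

lemma norm_real2_squared: "(norm (z :: real^2))\<^sup>2 = (z $ 1)\<^sup>2 + (z $ 2)\<^sup>2"
  unfolding power2_norm_eq_inner by (simp add: inner_vec_def sum_2 power2_eq_square)

text \<open>The closest point projection onto \<open>S\<close> maps the circle of radius \<open>R\<close> onto a superset of the
  part of the frontier inside the disc, and it does not increase lengths.\<close>

lemma hausdorff1_frontier_convex_le:
  fixes S :: "(real^2) set"
  assumes "convex S" "closed S" "R > 0"
  shows "hausdorff1_outer (frontier S \<inter> cball 0 R) \<le> ennreal (R * (2 * pi))"
proof (cases "S = {}")
  case False
  define c :: "real \<Rightarrow> real^2" where "c t = vector [cos t, sin t]" for t
  define f where "f t = closest_point S (R *\<^sub>R c t)" for t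
  have "norm (c s - c t) \<le> \<bar>s - t\<bar>" for s t
  proof -
    have "(norm (c s - c t))\<^sup>2 = (cos s - cos t)\<^sup>2 + (sin s - sin t)\<^sup>2"
      by (simp add: norm_real2_squared c_def)
    also have "\<dots> = 2 - 2 * cos (s - t)"
      using sin_cos_squared_add[of s] sin_cos_squared_add[of t]
      unfolding cos_diff power2_diff by (simp add: algebra_simps)
    also have "\<dots> = 4 * (sin ((s - t) / 2))\<^sup>2"
      using cos_double_sin[of "(s - t) / 2"] unfolding mult_2 field_sum_of_halves by simp
    also have "\<dots> \<le> 4 * \<bar>(s - t) / 2\<bar>\<^sup>2"
      using abs_sin_x_le_abs_x[of "(s - t) / 2"] by (intro mult_left_mono) (auto simp flip: abs_le_square_iff)
    also have "\<dots> = \<bar>s - t\<bar>\<^sup>2" by (simp add: power2_eq_square)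
    finally show ?thesis by (rule power2_le_imp_le) simp
  qed
  then have lip: "norm (f s - f t) \<le> R * \<bar>s - t\<bar>" for s t
    using closest_point_lipschitz[OF assms(1,2) False, of "R *\<^sub>R c s" "R *\<^sub>R c t"] assms(3)
    by (auto simp: f_def dist_norm simp flip: scaleR_diff_right elim!: order_trans)
  have "frontier S \<inter> cball 0 R \<subseteq> f ` {0..2 * pi}"
  proof
    fix q assume q: "q \<in> frontier S \<inter> cball 0 R"
    obtain v where v: "v \<noteq> 0" "\<And>y. y \<in> closure S \<Longrightarrow> v \<bullet> q \<le> v \<bullet> y"
      using supporting_hyperplane_frontier[OF assms(1)] q by blast
    have qS: "q \<in> S" using q assms(2) by (auto simp: frontier_def)
    \<comment> \<open>The outer normal ray starts in the disc and has left its interior after length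
      \<open>2 * R\<close>, since \<open>norm q \<le> R\<close>; so it crosses the circle at a point
      that projects back to \<open>q\<close>.\<close>
    have "\<exists>s\<ge>0. s \<le> 2 * R / norm v \<and> norm (q - s *\<^sub>R v) = R"
    proof (rule IVT')
      have "norm ((2 * R / norm v) *\<^sub>R v) \<le> norm (q - (2 * R / norm v) *\<^sub>R v) + norm q"
        by (metis add.commute norm_minus_commute norm_triangle_sub)
      then show "R \<le> norm (q - (2 * R / norm v) *\<^sub>R v)" using q v(1) assms(3) by simp
    qed (use q assms(3) in \<open>auto intro!: continuous_intros\<close>)
    then obtain s where s: "0 \<le> s" "norm (q - s *\<^sub>R v) = R" by auto
    define z where "z = q - s *\<^sub>R v"
    have "(norm z)\<^sup>2 = (z $ 1)\<^sup>2 + (z $ 2)\<^sup>2"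
      by (rule norm_real2_squared)
    then have "(z $ 1 / R)\<^sup>2 + (z $ 2 / R)\<^sup>2 = 1"
      using s(2) assms(3) unfolding power_divide add_divide_distrib[symmetric]
      by (metis div_self less_irrefl power_not_zero z_def)
    then obtain t where t: "0 \<le> t" "t < 2 * pi" "z $ 1 / R = cos t" "z $ 2 / R = sin t"
      using sincos_total_2pi by blast
    then have "z = R *\<^sub>R c t" using assms(3)
      by (simp add: vec_eq_iff forall_2 c_def field_simps)
    then have "f t = q" unfolding f_def z_def
      using closest_point_normal[OF assms(1,2) qS s(1), of v] v(2) assms(2) by simp
    with t show "q \<in> f ` {0..2 * pi}" by (auto intro!: image_eqI[of _ _ t])
  qed
  then have "hausdorff1_outer (frontier S \<inter> cball 0 R) \<le> hausdorff1_outer (f ` {0..2 * pi})"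
    by (rule hausdorff1_outer_mono)
  also have "\<dots> \<le> ennreal (R * (2 * pi - 0))"
    using assms(3) lip by (intro hausdorff1_outer_lipschitz_image_le) auto
  finally show ?thesis by simp
qed (simp add: hausdorff1_outer_empty)

lemma gauss_h1_frontier_convex_finite:
  assumes "convex S"
  shows "emeasure gauss_h1 (frontier S) < \<infinity>"
proof -
  define A where "A n = frontier S \<inter> {x. real n \<le> norm x \<and> norm x \<le> real n + 1}" for n
  have clA: "closed (A n)" for n
    unfolding A_def by (intro closed_Int frontier_closed closed_Collect_conj closed_Collect_le continuous_intros)
  then have Am: "A n \<in> sets borel" for n by (rule borel_closed)
  \<comment> \<open>The length bound is for closed sets. A convex set and its closure have the same
    interior, which transfers the frontier.\<close>
  have frc: "frontier S \<subseteq> frontier (closure S)"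
    using assms by (simp add: frontier_def convex_interior_closure)
  have bound: "emeasure gauss_h1 (A n) \<le> ennreal (2 * pi * exp 2 * exp (-1) ^ n)" for n
  proof -
    have "emeasure hausdorff1 (A n) \<le> hausdorff1_outer (frontier (closure S) \<inter> cball 0 (real n + 1))"
      unfolding emeasure_hausdorff1[OF Am] using frc by (intro hausdorff1_outer_mono) (auto simp: A_def)
    also have "\<dots> \<le> ennreal ((real n + 1) * (2 * pi))"
      using assms by (intro hausdorff1_frontier_convex_le convex_closure) auto
    finally have 1: "emeasure hausdorff1 (A n) \<le> ennreal ((real n + 1) * (2 * pi))" .
    have "emeasure gauss_h1 (A n) \<le> ennreal (exp (- (real n)\<^sup>2 / 2)) * emeasure hausdorff1 (A n)"
      unfolding gauss_h1_def using Am
      by (intro emeasure_density_bounds measurable_gauss_weight)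
        (auto simp: A_def intro!: ennreal_leI power_mono)
    also have "\<dots> \<le> ennreal (exp (- (real n)\<^sup>2 / 2)) * ennreal ((real n + 1) * (2 * pi))"
      by (intro mult_left_mono 1) auto
    also have "\<dots> = ennreal (exp (- (real n)\<^sup>2 / 2) * ((real n + 1) * (2 * pi)))"
      by (simp add: ennreal_mult)
    also have "\<dots> \<le> ennreal (2 * pi * exp 2 * exp (-1) ^ n)"
    proof (rule ennreal_leI)
      \<comment> \<open>From \<open>(n - 2)\<^sup>2 \<ge> 0\<close> one gets
        \<open>- n\<^sup>2 / 2 \<le> 2 - 2 * n\<close>, while \<open>n + 1 \<le> exp n\<close>; the
        product is a geometric term.\<close>
      have "exp (- (real n)\<^sup>2 / 2) * (real n + 1) \<le> exp (2 - 2 * real n) * exp (real n)"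
        using zero_le_power2[of "real n - 2"] exp_ge_add_one_self[of "real n"]
        by (intro mult_mono) (auto simp: power2_eq_square algebra_simps)
      also have "\<dots> = exp 2 * exp (-1) ^ n"
        by (simp flip: exp_add exp_of_nat_mult)
      finally have "exp (- (real n)\<^sup>2 / 2) * (real n + 1) * (2 * pi) \<le> exp 2 * exp (-1) ^ n * (2 * pi)"
        by (intro mult_right_mono) auto
      then show "exp (- (real n)\<^sup>2 / 2) * ((real n + 1) * (2 * pi)) \<le> 2 * pi * exp 2 * exp (-1) ^ n"
        by (simp add: algebra_simps)
    qed
    finally show ?thesis .
  qed
  have "frontier S \<subseteq> (\<Union>n. A n)"
  proof
    fix x assume "x \<in> frontier S"
    then have "x \<in> A (nat \<lfloor>norm x\<rfloor>)" by (auto simp: A_def)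
    then show "x \<in> (\<Union>n. A n)" by blast
  qed
  then have "emeasure gauss_h1 (frontier S) \<le> emeasure gauss_h1 (\<Union>n. A n)"
    using Am by (intro emeasure_mono) auto
  also have "\<dots> \<le> (\<Sum>n. emeasure gauss_h1 (A n))"
    using Am by (intro emeasure_subadditive_countably) auto
  also have "\<dots> \<le> (\<Sum>n. ennreal (2 * pi * exp 2 * exp (-1) ^ n))"
    by (intro suminf_le allI bound) auto
  also have "\<dots> < \<infinity>"
  proof -
    have "summable (\<lambda>n. 2 * pi * exp 2 * exp (-1 :: real) ^ n)"
      by (intro summable_mult summable_geometric) auto
    then show ?thesis by (subst suminf_ennreal2) auto
  qed
  finally show ?thesis .
qed

section \<open>Second variation of the Gaussian length of a graph\<close>

text \<open>A quantitative form of strict convexity: the second derivative of the root is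
  \<open>(1 + p\<^sup>2)\<close> to the power -3/2, whence \<open>B ^ 3\<close>. It is obtained
  without derivatives from
  \<open>(S p * S r)\<^sup>2 = (1 + p * r)\<^sup>2 + (r - p)\<^sup>2\<close>, which sharpens
  Cauchy-Schwarz for the vectors \<open>(1, p)\<close> and \<open>(1, r)\<close>, used with
  \<open>r = p + q\<close> and \<open>r = p - q\<close>.\<close>

lemma sqrt_add_second_difference:
  fixes p q :: real
  assumes "sqrt (1 + p\<^sup>2) \<le> B" "sqrt (1 + (p + q)\<^sup>2) \<le> B" "sqrt (1 + (p - q)\<^sup>2) \<le> B"
  shows "2 * sqrt (1 + p\<^sup>2) + q\<^sup>2 / B ^ 3 \<le> sqrt (1 + (p + q)\<^sup>2) + sqrt (1 + (p - q)\<^sup>2)"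
proof -
  define S where "S x = sqrt (1 + x\<^sup>2)" for x :: real
  have S1: "1 \<le> S x" for x by (simp add: S_def)
  have S2: "S x * S x = 1 + x\<^sup>2" for x by (simp add: S_def)
  have B: "1 \<le> B" using order_trans[OF S1[of p]] assms(1) by (simp add: S_def)
  have cs: "1 + p * r + (r - p)\<^sup>2 / (2 * B\<^sup>2) \<le> S p * S r" if "S r \<le> B" for r
  proof -
    have sp: "S p \<le> B" using assms by (simp add: S_def)
    have eq: "(S p * S r)\<^sup>2 = (1 + p * r)\<^sup>2 + (r - p)\<^sup>2"
      using S2[of p] S2[of r] by (simp add: power2_eq_square algebra_simps)
    have pos: "0 < S p * S r" using S1[of p] S1[of r] by (simp add: mult_pos_pos)
    have le: "1 + p * r \<le> S p * S r"
    proof (rule power2_le_imp_le)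
      show "(1 + p * r)\<^sup>2 \<le> (S p * S r)\<^sup>2" unfolding eq by simp
    qed (use pos in simp)
    have SB: "S p * S r \<le> B\<^sup>2"
      unfolding power2_eq_square using that sp S1[of p] S1[of r] B by (intro mult_mono) auto
    have "(r - p)\<^sup>2 = (S p * S r - (1 + p * r)) * (S p * S r + (1 + p * r))"
      using eq by (simp add: power2_eq_square algebra_simps)
    also have "\<dots> \<le> (S p * S r - (1 + p * r)) * (2 * B\<^sup>2)"
      using le SB by (intro mult_left_mono) auto
    finally have "(r - p)\<^sup>2 / (2 * B\<^sup>2) \<le> S p * S r - (1 + p * r)"
      using B by (simp add: pos_divide_le_eq)
    then show ?thesis by simp
  qed
  have "2 * S p * S p + q\<^sup>2 / B\<^sup>2 \<le> S p * (S (p + q) + S (p - q))"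
  proof -
    have "1 + p * (p + q) + q\<^sup>2 / (2 * B\<^sup>2) \<le> S p * S (p + q)"
      using cs[of "p + q"] assms by (simp add: S_def)
    moreover have "1 + p * (p - q) + q\<^sup>2 / (2 * B\<^sup>2) \<le> S p * S (p - q)"
      using cs[of "p - q"] assms by (simp add: S_def)
    moreover have "q\<^sup>2 / B\<^sup>2 = q\<^sup>2 / (2 * B\<^sup>2) + q\<^sup>2 / (2 * B\<^sup>2)" by simp
    moreover have "2 * S p * S p = (1 + p * (p + q)) + (1 + p * (p - q))"
      using S2[of p] by (simp add: algebra_simps power2_eq_square)
    ultimately show ?thesis unfolding distrib_left by linarith
  qed
  moreover have "S p * (q\<^sup>2 / B ^ 3) \<le> q\<^sup>2 / B\<^sup>2"
  proof -
    have "S p * (q\<^sup>2 / B ^ 3) \<le> B * (q\<^sup>2 / B ^ 3)"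
      using assms B by (intro mult_right_mono) (auto simp: S_def)
    also have "\<dots> = q\<^sup>2 / B\<^sup>2" using B by (simp add: power2_eq_square power3_eq_cube)
    finally show ?thesis .
  qed
  ultimately have "S p * (2 * S p + q\<^sup>2 / B ^ 3) \<le> S p * (S (p + q) + S (p - q))"
    by (simp add: algebra_simps)
  then show ?thesis using S1[of p] by (simp add: S_def[symmetric])
qed

lemma sqrt_one_plus_square_lipschitz:
  fixes x y :: real
  shows "\<bar>sqrt (1 + x\<^sup>2) - sqrt (1 + y\<^sup>2)\<bar> \<le> \<bar>x - y\<bar>"
proof -
  have "\<bar>norm (1::real, x) - norm (1::real, y)\<bar> \<le> norm ((1::real, x) - (1, y))"
    by (rule norm_triangle_ineq3)
  then show ?thesis by (simp add: norm_Pair)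
qed

text \<open>After the common factor is taken out, the mixed terms combine to twice
  \<open>cosh (y * u)\<close>, which is at least 2; only a loss of order \<open>u\<^sup>2\<close>
  remains.\<close>

lemma gauss_second_difference:
  fixes y u :: real
  shows "2 * exp (- y\<^sup>2 / 2) * (1 - u\<^sup>2 / 2) \<le> exp (- (y + u)\<^sup>2 / 2) + exp (- (y - u)\<^sup>2 / 2)"
proof -
  have "exp (- (y + u)\<^sup>2 / 2) + exp (- (y - u)\<^sup>2 / 2)
      = exp (- y\<^sup>2 / 2) * exp (- u\<^sup>2 / 2) * (exp (y * u) + exp (- (y * u)))"
    by (simp add: distrib_left power2_eq_square field_simps flip: exp_add)
  moreover have "2 \<le> exp (y * u) + exp (- (y * u))"
    using cosh_real_ge_1[of "y * u"] by (simp add: cosh_field_def)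
  ultimately have "exp (- y\<^sup>2 / 2) * exp (- u\<^sup>2 / 2) * 2 \<le> exp (- (y + u)\<^sup>2 / 2) + exp (- (y - u)\<^sup>2 / 2)"
    by (simp add: mult_left_mono)
  moreover have "exp (- y\<^sup>2 / 2) * (1 - u\<^sup>2 / 2) \<le> exp (- y\<^sup>2 / 2) * exp (- u\<^sup>2 / 2)"
    using exp_ge_add_one_self[of "- u\<^sup>2 / 2"] by (intro mult_left_mono) auto
  ultimately show ?thesis by linarith
qed

lemma gauss_lipschitz:
  fixes x y :: real
  shows "\<bar>exp (- x\<^sup>2 / 2) - exp (- y\<^sup>2 / 2)\<bar> \<le> \<bar>x - y\<bar>"
proof -
  have "norm (exp (- x\<^sup>2 / 2) - exp (- y\<^sup>2 / 2)) \<le> 1 * norm (x - y)"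
  proof (rule field_differentiable_bound[where S = UNIV])
    show "((\<lambda>z. exp (- z\<^sup>2 / 2)) has_field_derivative - z * exp (- z\<^sup>2 / 2)) (at z within UNIV)"
      for z :: real by (auto intro!: derivative_eq_intros)
    show "norm (- z * exp (- z\<^sup>2 / 2)) \<le> 1" for z :: real
    proof -
      have "0 \<le> (\<bar>z\<bar> - 1)\<^sup>2" by simp
      then have "\<bar>z\<bar> \<le> 1 + z\<^sup>2 / 2" by (simp add: power2_diff)
      also have "\<dots> \<le> exp (z\<^sup>2 / 2)" by (rule exp_ge_add_one_self)
      finally show ?thesis by (simp add: abs_mult exp_minus field_simps)
    qed
  qed auto
  then show ?thesis by simp
qed

section \<open>Second difference of the length integrand\<close>

definition gauss_lagrangian :: "real \<Rightarrow> real \<Rightarrow> real \<Rightarrow> real" where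
  "gauss_lagrangian x y p = exp (- (x\<^sup>2 + y\<^sup>2) / 2) * sqrt (1 + p\<^sup>2)"

text \<open>Convexity in the slope yields a gain of order \<open>q\<^sup>2\<close>, the Gaussian
  weight a loss of order \<open>u\<^sup>2\<close>. The mixed term of order
  \<open>\<bar>u\<bar> * \<bar>q\<bar>\<close> is absorbed by giving up half of the gain.\<close>

lemma gauss_lagrangian_second_difference:
  fixes X Y P :: real
  obtains c C where "c > 0" "C > 0"
    "\<And>x y p u q. \<lbrakk>\<bar>x\<bar> \<le> X; \<bar>y\<bar> \<le> Y; \<bar>p\<bar> \<le> P; \<bar>u\<bar> \<le> 1; \<bar>q\<bar> \<le> 1\<rbrakk> \<Longrightarrow>
       c * q\<^sup>2 - C * u\<^sup>2 \<le> gauss_lagrangian x (y + u) (p + q) + gauss_lagrangian x (y - u) (p - q)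
          - 2 * gauss_lagrangian x y p"
proof -
  \<comment> \<open>\<open>B\<close> bounds the root at \<open>p\<close> and at
    \<open>p + q\<close>, \<open>p - q\<close>. The gain coefficient \<open>e\<close> collects
    \<open>exp (- Y\<^sup>2 / 2) \<le> E0\<close>, \<open>1 / 2 \<le> 1 - u\<^sup>2 / 2\<close> and
    the convexity constant \<open>1 / B ^ 3\<close>.\<close>
  define B where "B = sqrt (1 + (\<bar>P\<bar> + 1)\<^sup>2)"
  define e where "e = exp (- Y\<^sup>2 / 2) / (2 * B ^ 3)"
  have B: "1 \<le> B" by (simp add: B_def)
  have e: "e > 0" using B by (simp add: e_def)
  define D where "D = B + 2 / e"
  have D: "D > 0" using B e by (simp add: D_def add_pos_pos)
  have key: "e / 2 * q\<^sup>2 - D * u\<^sup>2 \<le> exp (- (y + u)\<^sup>2 / 2) * sqrt (1 + (p + q)\<^sup>2)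
      + exp (- (y - u)\<^sup>2 / 2) * sqrt (1 + (p - q)\<^sup>2) - 2 * (exp (- y\<^sup>2 / 2) * sqrt (1 + p\<^sup>2))"
    if "\<bar>y\<bar> \<le> Y" "\<bar>p\<bar> \<le> P" "\<bar>u\<bar> \<le> 1" "\<bar>q\<bar> \<le> 1" for y p u q
  proof -
    define E0 Ep Em Q Sp Sm where "E0 = exp (- y\<^sup>2 / 2)" "Ep = exp (- (y + u)\<^sup>2 / 2)"
      "Em = exp (- (y - u)\<^sup>2 / 2)" "Q = sqrt (1 + p\<^sup>2)" "Sp = sqrt (1 + (p + q)\<^sup>2)"
      "Sm = sqrt (1 + (p - q)\<^sup>2)"
    note d = E0_Ep_Em_Q_Sp_Sm_def
    have SB: "sqrt (1 + x\<^sup>2) \<le> B" if "\<bar>x\<bar> \<le> \<bar>P\<bar> + 1" for x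
      unfolding B_def using that by (intro real_sqrt_le_mono add_left_mono) (auto simp flip: abs_le_square_iff)
    have Q: "1 \<le> Q" "Q \<le> B" using SB[of p] that by (auto simp: d)
    have s: "2 * Q + q\<^sup>2 / B ^ 3 \<le> Sp + Sm"
      unfolding d using that by (intro sqrt_add_second_difference SB) auto
    have sd: "\<bar>Sp - Sm\<bar> \<le> 2 * \<bar>q\<bar>"
      using sqrt_one_plus_square_lipschitz[of "p + q" "p - q"] by (simp add: d)
    have g: "2 * E0 * (1 - u\<^sup>2 / 2) \<le> Ep + Em" using gauss_second_difference by (simp add: d)
    have gd: "\<bar>Ep - Em\<bar> \<le> 2 * \<bar>u\<bar>"
      using gauss_lipschitz[of "y + u" "y - u"] by (simp add: d)
    have E0: "0 < E0" "E0 \<le> 1" by (auto simp: d)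
    have u2: "u\<^sup>2 \<le> 1" using that by (simp add: abs_square_le_1)
    have E0e: "e * (2 * B ^ 3) \<le> E0"
      using that B by (simp add: d e_def abs_le_square_iff[symmetric])
    have "(2 * E0 * (1 - u\<^sup>2 / 2)) * (2 * Q + q\<^sup>2 / B ^ 3) \<le> (Ep + Em) * (Sp + Sm)"
      using g s u2 E0 Q B by (intro mult_mono) (auto simp: d)
    moreover have "- (4 * (\<bar>u\<bar> * \<bar>q\<bar>)) \<le> (Ep - Em) * (Sp - Sm)"
    proof -
      have "\<bar>(Ep - Em) * (Sp - Sm)\<bar> \<le> (2 * \<bar>u\<bar>) * (2 * \<bar>q\<bar>)"
        unfolding abs_mult using sd gd by (intro mult_mono) auto
      then show ?thesis by simp
    qed
    \<comment> \<open>This separates the product of sums, which carries both second differences,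
      from the product of differences, which the Lipschitz bounds control.\<close>
    moreover have "Ep * Sp + Em * Sm = ((Ep + Em) * (Sp + Sm) + (Ep - Em) * (Sp - Sm)) / 2"
      by (simp add: field_simps)
    moreover have "(2 * E0 * (1 - u\<^sup>2 / 2)) * (2 * Q + q\<^sup>2 / B ^ 3)
        = 2 * (E0 * (1 - u\<^sup>2 / 2) * (2 * Q + q\<^sup>2 / B ^ 3))"
      by (simp only: mult.assoc)
    ultimately have 1: "E0 * (1 - u\<^sup>2 / 2) * (2 * Q + q\<^sup>2 / B ^ 3) - 2 * (\<bar>u\<bar> * \<bar>q\<bar>) \<le> Ep * Sp + Em * Sm"
      by argo
    have 2: "2 * (\<bar>u\<bar> * \<bar>q\<bar>) \<le> e / 2 * q\<^sup>2 + 2 / e * u\<^sup>2"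
    proof -
      have "0 \<le> (e * \<bar>q\<bar> - 2 * \<bar>u\<bar>)\<^sup>2 / (2 * e)" using e by simp
      also have "\<dots> = e / 2 * q\<^sup>2 + 2 / e * u\<^sup>2 - 2 * (\<bar>u\<bar> * \<bar>q\<bar>)"
        using e by (simp add: power2_diff power_mult_distrib field_simps power2_eq_square)
      finally show ?thesis by simp
    qed
    have 3: "e * q\<^sup>2 \<le> E0 * (1 - u\<^sup>2 / 2) * (q\<^sup>2 / B ^ 3)"
    proof -
      have "e * q\<^sup>2 = (e * (2 * B ^ 3)) * (1 / 2) * (q\<^sup>2 / B ^ 3)" using B by simp
      also have "\<dots> \<le> E0 * (1 - u\<^sup>2 / 2) * (q\<^sup>2 / B ^ 3)"
        using E0e u2 E0 B by (intro mult_right_mono mult_mono) auto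
      finally show ?thesis .
    qed
    have 4: "2 * (E0 * Q) - B * u\<^sup>2 \<le> E0 * (1 - u\<^sup>2 / 2) * (2 * Q)"
    proof -
      have "E0 * Q * u\<^sup>2 \<le> 1 * B * u\<^sup>2" using E0 Q by (intro mult_right_mono mult_mono) auto
      then show ?thesis by (simp add: algebra_simps)
    qed
    have "E0 * (1 - u\<^sup>2 / 2) * (2 * Q + q\<^sup>2 / B ^ 3)
        = E0 * (1 - u\<^sup>2 / 2) * (2 * Q) + E0 * (1 - u\<^sup>2 / 2) * (q\<^sup>2 / B ^ 3)"
      by (rule distrib_left)
    with 1 2 3 4 have "e / 2 * q\<^sup>2 - (B * u\<^sup>2 + 2 / e * u\<^sup>2) \<le> Ep * Sp + Em * Sm - 2 * (E0 * Q)"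
      by linarith
    then show ?thesis by (simp add: d D_def distrib_right)
  qed
  show ?thesis
  proof (rule that[of "exp (- X\<^sup>2 / 2) * (e / 2)" D])
    fix x y p u q :: real assume a: "\<bar>x\<bar> \<le> X" "\<bar>y\<bar> \<le> Y" "\<bar>p\<bar> \<le> P" "\<bar>u\<bar> \<le> 1" "\<bar>q\<bar> \<le> 1"
    have fac: "gauss_lagrangian x y p = exp (- x\<^sup>2 / 2) * (exp (- y\<^sup>2 / 2) * sqrt (1 + p\<^sup>2))" for y p
      by (simp add: gauss_lagrangian_def field_simps flip: exp_add)
    have "exp (- X\<^sup>2 / 2) * (e / 2) * q\<^sup>2 \<le> exp (- x\<^sup>2 / 2) * (e / 2) * q\<^sup>2"
      using a e by (intro mult_right_mono) (auto simp: abs_le_square_iff[symmetric])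
    moreover have "exp (- x\<^sup>2 / 2) * (D * u\<^sup>2) \<le> 1 * (D * u\<^sup>2)"
      using D by (intro mult_right_mono) auto
    ultimately have "exp (- X\<^sup>2 / 2) * (e / 2) * q\<^sup>2 - D * u\<^sup>2
        \<le> exp (- x\<^sup>2 / 2) * (e / 2 * q\<^sup>2 - D * u\<^sup>2)"
      by (simp add: algebra_simps)
    also have "\<dots> \<le> exp (- x\<^sup>2 / 2) * (exp (- (y + u)\<^sup>2 / 2) * sqrt (1 + (p + q)\<^sup>2)
      + exp (- (y - u)\<^sup>2 / 2) * sqrt (1 + (p - q)\<^sup>2) - 2 * (exp (- y\<^sup>2 / 2) * sqrt (1 + p\<^sup>2)))"
      using key[OF a(2-)] by (intro mult_left_mono) auto
    finally show "exp (- X\<^sup>2 / 2) * (e / 2) * q\<^sup>2 - D * u\<^sup>2 \<le> gauss_lagrangian x (y + u) (p + q)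
        + gauss_lagrangian x (y - u) (p - q) - 2 * gauss_lagrangian x y p"
      unfolding fac by (simp add: algebra_simps)
  qed (use e D in auto)
qed

text \<open>The bump is a fixed polynomial vanishing to second order at both ends, so every estimate
  is explicit. In place of a Poincare inequality the second difference is bounded below pointwise by
  a polynomial whose integral is computed exactly.\<close>

lemma convex_graph_perturbation:
  fixes f f' f'' :: "real \<Rightarrow> real"
  assumes "r > 0" "m > 0"
    and f: "\<And>x. \<bar>x - x0\<bar> < r \<Longrightarrow> (f has_real_derivative f' x) (at x)"
    and f': "\<And>x. \<bar>x - x0\<bar> < r \<Longrightarrow> (f' has_real_derivative f'' x) (at x)"
    and f'': "\<And>x. \<bar>x - x0\<bar> < r \<Longrightarrow> m \<le> f'' x"
  obtains \<epsilon> :: real and u u' where "0 < \<epsilon>" "\<epsilon> < r" "\<And>x. (u has_real_derivative u' x) (at x)"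
    "continuous_on UNIV u'"
    "u (x0 - \<epsilon>) = 0" "u (x0 + \<epsilon>) = 0" "u' (x0 - \<epsilon>) = 0" "u' (x0 + \<epsilon>) = 0"
    "\<And>\<sigma>. \<bar>\<sigma>\<bar> \<le> 1 \<Longrightarrow> strict_mono_on {x0 - \<epsilon>..x0 + \<epsilon>} (\<lambda>x. f' x + \<sigma> * u' x)"
    "\<And>Jp Jm J. \<lbrakk>((\<lambda>x. gauss_lagrangian x (f x) (f' x)) has_integral J) {x0 - \<epsilon>..x0 + \<epsilon>};
       ((\<lambda>x. gauss_lagrangian x (f x + u x) (f' x + u' x)) has_integral Jp) {x0 - \<epsilon>..x0 + \<epsilon>};
       ((\<lambda>x. gauss_lagrangian x (f x - u x) (f' x - u' x)) has_integral Jm) {x0 - \<epsilon>..x0 + \<epsilon>}\<rbrakk>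
      \<Longrightarrow> 2 * J < Jp + Jm"
proof -
  let ?I = "{x0 - r / 2..x0 + r / 2}"
  have inI: "\<bar>x - x0\<bar> < r" if "x \<in> ?I" for x
    using that assms(1) by (simp add: abs_less_iff)
  have cont: "continuous_on ?I f" "continuous_on ?I f'"
    by (rule DERIV_continuous_on[OF has_field_derivative_at_within[OF f[OF inI]]], assumption,
        rule DERIV_continuous_on[OF has_field_derivative_at_within[OF f'[OF inI]]], assumption)
  obtain Y where Y: "\<And>x. x \<in> ?I \<Longrightarrow> \<bar>f x\<bar> \<le> Y"
    using compact_continuous_image[OF cont(1), THEN compact_imp_bounded] by (force simp: bounded_iff)
  obtain Pm where Pm: "\<And>x. x \<in> ?I \<Longrightarrow> \<bar>f' x\<bar> \<le> Pm"
    using compact_continuous_image[OF cont(2), THEN compact_imp_bounded] by (force simp: bounded_iff)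
  obtain c C where cC: "c > 0" "C > 0" and
    L: "\<And>x y p u q. \<lbrakk>\<bar>x\<bar> \<le> \<bar>x0\<bar> + r; \<bar>y\<bar> \<le> Y; \<bar>p\<bar> \<le> Pm; \<bar>u\<bar> \<le> 1; \<bar>q\<bar> \<le> 1\<rbrakk> \<Longrightarrow>
       c * q\<^sup>2 - C * u\<^sup>2 \<le> gauss_lagrangian x (y + u) (p + q) + gauss_lagrangian x (y - u) (p - q)
          - 2 * gauss_lagrangian x y p"
    using gauss_lagrangian_second_difference[of "\<bar>x0\<bar> + r" Y Pm] by metis
  \<comment> \<open>\<open>r / 2\<close> keeps the support where \<open>f\<close> and
    \<open>f'\<close> are bounded, 1 keeps the bump small, and the root gives
    \<open>C * \<epsilon>\<^sup>2 \<le> c\<close>, the precise meaning of a short support.\<close>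
  define \<epsilon> where "\<epsilon> = min (r / 2) (min 1 (sqrt (c / C)))"
  have "\<epsilon> > 0" "\<epsilon> \<le> r / 2" "\<epsilon> \<le> 1" "\<epsilon> \<le> sqrt (c / C)" using assms cC by (auto simp: \<epsilon>_def)
  have "\<epsilon>\<^sup>2 \<le> (sqrt (c / C))\<^sup>2" using \<open>\<epsilon> \<le> sqrt (c / C)\<close> \<open>\<epsilon> > 0\<close> by (intro power_mono) auto
  also have "\<dots> = c / C" using cC by simp
  finally have "C * \<epsilon>\<^sup>2 \<le> c" using cC by (simp add: pos_le_divide_eq mult.commute)
  then have \<epsilon>: "\<epsilon> > 0" "\<epsilon> \<le> r / 2" "\<epsilon> < r" "\<epsilon> \<le> 1" "C * \<epsilon>\<^sup>2 \<le> c"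
    using \<open>\<epsilon> > 0\<close> \<open>\<epsilon> \<le> r / 2\<close> \<open>\<epsilon> \<le> 1\<close> assms(1) by linarith+
  \<comment> \<open>\<open>1 / 4\<close> gives \<open>\<bar>u'\<bar> \<le> 1\<close>. As
    \<open>\<bar>u''\<bar> \<le> 8 * \<eta>\<close> on the support, \<open>m / 16\<close> keeps
    \<open>\<bar>u''\<bar>\<close> below \<open>m\<close>, so that both perturbations stay strictly
    convex.\<close>
  define \<eta> where "\<eta> = min (1 / 4) (m / 16)"
  have \<eta>: "\<eta> > 0" "\<eta> \<le> 1 / 4" "8 * \<eta> < m" using assms by (auto simp: \<eta>_def min_def)
  define u where "u x = \<eta> * (\<epsilon>\<^sup>2 - (x - x0)\<^sup>2)\<^sup>2" for x
  define u' where "u' x = - 4 * \<eta> * (x - x0) * (\<epsilon>\<^sup>2 - (x - x0)\<^sup>2)" for x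
  define u'' where "u'' x = - 4 * \<eta> * (\<epsilon>\<^sup>2 - 3 * (x - x0)\<^sup>2)" for x
  let ?E = "{x0 - \<epsilon>..x0 + \<epsilon>}"
  have du: "(u has_real_derivative u' x) (at x)" for x
    unfolding u_def u'_def by (rule derivative_eq_intros refl)+ (simp add: algebra_simps)
  have du': "(u' has_real_derivative u'' x) (at x)" for x
    unfolding u'_def u''_def
    by (rule derivative_eq_intros refl)+ (simp add: power2_eq_square algebra_simps)
  have sq: "(x - x0)\<^sup>2 \<le> \<epsilon>\<^sup>2" "\<bar>x - x0\<bar> \<le> \<epsilon>" if "x \<in> ?E" for x
    using that \<epsilon> by (auto simp: abs_le_square_iff[symmetric])
  have e1: "\<epsilon>\<^sup>2 \<le> 1" using \<epsilon> by (simp add: power_le_one)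
  have ub: "\<bar>u x\<bar> \<le> 1" "\<bar>u' x\<bar> \<le> 1" "\<bar>u'' x\<bar> < m" if "x \<in> ?E" for x
  proof -
    have a: "0 \<le> \<epsilon>\<^sup>2 - (x - x0)\<^sup>2" "\<epsilon>\<^sup>2 - (x - x0)\<^sup>2 \<le> 1"
      using sq[OF that] e1 zero_le_power2[of "x - x0"] by linarith+
    then have "(\<epsilon>\<^sup>2 - (x - x0)\<^sup>2)\<^sup>2 \<le> 1" by (simp add: power_le_one)
    then have "\<eta> * (\<epsilon>\<^sup>2 - (x - x0)\<^sup>2)\<^sup>2 \<le> 1 * 1" using \<eta> by (intro mult_mono) auto
    then show "\<bar>u x\<bar> \<le> 1" using \<eta> by (simp add: u_def)
    have "\<bar>u' x\<bar> = 4 * \<eta> * \<bar>x - x0\<bar> * (\<epsilon>\<^sup>2 - (x - x0)\<^sup>2)"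
      using \<eta> a by (simp add: u'_def abs_mult)
    also have "\<dots> \<le> 1 * 1 * 1" using \<eta> a sq[OF that] \<epsilon> by (intro mult_mono) auto
    finally show "\<bar>u' x\<bar> \<le> 1" by simp
    have "\<bar>u'' x\<bar> = 4 * \<eta> * \<bar>\<epsilon>\<^sup>2 - 3 * (x - x0)\<^sup>2\<bar>" using \<eta> by (simp add: u''_def abs_mult)
    also have "\<dots> \<le> 4 * \<eta> * 2"
      using \<eta> a sq[OF that] e1 zero_le_power2[of "x - x0"] by (intro mult_left_mono abs_leI) linarith+
    finally show "\<bar>u'' x\<bar> < m" using \<eta> by simp
  qed
  show ?thesis
  proof (rule that[of \<epsilon> u u'])
    show "continuous_on UNIV u'" unfolding u'_def by (intro continuous_intros)
  next
    fix \<sigma> :: real assume "\<bar>\<sigma>\<bar> \<le> 1"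
    show "strict_mono_on ?E (\<lambda>x. f' x + \<sigma> * u' x)"
    proof (rule strict_mono_onI)
      fix s t assume st: "s \<in> ?E" "t \<in> ?E" "s < t"
      show "f' s + \<sigma> * u' s < f' t + \<sigma> * u' t"
      proof (rule DERIV_pos_imp_increasing[OF st(3)])
        fix x assume x: "s \<le> x" "x \<le> t"
        have xE: "x \<in> ?E" using x st by auto
        have "\<bar>\<sigma> * u'' x\<bar> \<le> 1 * \<bar>u'' x\<bar>" unfolding abs_mult
          using \<open>\<bar>\<sigma>\<bar> \<le> 1\<close> by (intro mult_right_mono) auto
        then have "0 < f'' x + \<sigma> * u'' x"
          using ub(3)[OF xE] f''[of x] sq(2)[OF xE] \<epsilon> by linarith
        moreover have "((\<lambda>x. f' x + \<sigma> * u' x) has_real_derivative f'' x + \<sigma> * u'' x) (at x)"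
          using sq(2)[OF xE] \<epsilon> by (intro DERIV_add f' DERIV_cmult du') auto
        ultimately show "\<exists>y. ((\<lambda>x. f' x + \<sigma> * u' x) has_real_derivative y) (at x) \<and> 0 < y" by blast
      qed
    qed
  next
    fix Jp Jm J
    assume J: "((\<lambda>x. gauss_lagrangian x (f x) (f' x)) has_integral J) ?E"
      and Jp: "((\<lambda>x. gauss_lagrangian x (f x + u x) (f' x + u' x)) has_integral Jp) ?E"
      and Jm: "((\<lambda>x. gauss_lagrangian x (f x - u x) (f' x - u' x)) has_integral Jm) ?E"
    \<comment> \<open>\<open>R\<close> is an antiderivative of the lower bound \<open>R'\<close> for the second difference of the integrand.\<close>
    define R where "R x = \<eta>\<^sup>2 * c * (- (\<epsilon> ^ 6) * (x - x0) + 19 / 3 * \<epsilon> ^ 4 * (x - x0) ^ 3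
        - 7 * \<epsilon>\<^sup>2 * (x - x0) ^ 5 + 17 / 7 * (x - x0) ^ 7)" for x
    define R' where "R' x = \<eta>\<^sup>2 * c * ((\<epsilon>\<^sup>2 - (x - x0)\<^sup>2)\<^sup>2 * (17 * (x - x0)\<^sup>2 - \<epsilon>\<^sup>2))" for x
    have dR: "(R has_real_derivative R' x) (at x within ?E)" for x
    proof -
      have eq: "R' x = \<eta>\<^sup>2 * c * (- (\<epsilon> ^ 6) + 19 * \<epsilon> ^ 4 * (x - x0)\<^sup>2 - 35 * \<epsilon>\<^sup>2 * (x - x0) ^ 4 + 17 * (x - x0) ^ 6)"
        unfolding R'_def by (intro arg_cong[of _ _ "\<lambda>z. \<eta>\<^sup>2 * c * z"]) algebra
      show ?thesis unfolding R_def eq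
        by (rule derivative_eq_intros refl)+ (simp add: algebra_simps)
    qed
    have iR: "(R' has_integral R (x0 + \<epsilon>) - R (x0 - \<epsilon>)) ?E"
      using dR \<epsilon> by (intro fundamental_theorem_of_calculus)
        (auto simp: has_real_derivative_iff_has_vector_derivative)
    \<comment> \<open>The factor is \<open>2 * (- 1 + 19 / 3 - 7 + 17 / 7)\<close>. Its positivity
      is what beats the negative values of \<open>R'\<close> near \<open>x0\<close>.\<close>
    have Rval: "R (x0 + \<epsilon>) - R (x0 - \<epsilon>) = \<eta>\<^sup>2 * c * (32 / 21 * \<epsilon> ^ 7)"
      by (simp add: R_def power_numeral_reduce field_simps)
    have "R (x0 + \<epsilon>) - R (x0 - \<epsilon>) \<le> (Jp + Jm) - 2 * J"
    proof (rule has_integral_le[OF iR])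
      show "((\<lambda>x. (gauss_lagrangian x (f x + u x) (f' x + u' x) + gauss_lagrangian x (f x - u x) (f' x - u' x))
          - 2 * gauss_lagrangian x (f x) (f' x)) has_integral (Jp + Jm) - 2 * J) ?E"
        by (intro has_integral_diff has_integral_add Jp Jm has_integral_mult_right J)
      fix x assume x: "x \<in> ?E"
      let ?s = "\<epsilon>\<^sup>2 - (x - x0)\<^sup>2"
      have a: "0 \<le> ?s" "?s \<le> \<epsilon>\<^sup>2" using sq[OF x] by auto
      \<comment> \<open>Replacing \<open>C * ?s\<^sup>2\<close> by
        \<open>c * ?s = c * (\<epsilon>\<^sup>2 - (x - x0)\<^sup>2)\<close> turns the 16 coming from
        \<open>u'\<close> into the 17 of \<open>R'\<close>.\<close>
      have "C * (?s * ?s) \<le> C * (\<epsilon>\<^sup>2 * ?s)" using a cC by (intro mult_left_mono mult_right_mono) auto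
      also have "\<dots> \<le> c * ?s" using \<epsilon>(5) a by (simp add: mult_right_mono flip: mult.assoc)
      finally have "C * ?s\<^sup>2 \<le> c * ?s" by (simp add: power2_eq_square)
      then have "c * (17 * (x - x0)\<^sup>2 - \<epsilon>\<^sup>2) \<le> 16 * c * (x - x0)\<^sup>2 - C * ?s\<^sup>2"
        by (simp add: algebra_simps)
      then have "\<eta>\<^sup>2 * ?s\<^sup>2 * (c * (17 * (x - x0)\<^sup>2 - \<epsilon>\<^sup>2)) \<le> \<eta>\<^sup>2 * ?s\<^sup>2 * (16 * c * (x - x0)\<^sup>2 - C * ?s\<^sup>2)"
        by (intro mult_left_mono) auto
      moreover have "R' x = \<eta>\<^sup>2 * ?s\<^sup>2 * (c * (17 * (x - x0)\<^sup>2 - \<epsilon>\<^sup>2))"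
        by (simp add: R'_def)
      moreover have "c * (u' x)\<^sup>2 - C * (u x)\<^sup>2 = \<eta>\<^sup>2 * ?s\<^sup>2 * (16 * c * (x - x0)\<^sup>2 - C * ?s\<^sup>2)"
        unfolding u_def u'_def by algebra
      moreover have "c * (u' x)\<^sup>2 - C * (u x)\<^sup>2 \<le> gauss_lagrangian x (f x + u x) (f' x + u' x)
          + gauss_lagrangian x (f x - u x) (f' x - u' x) - 2 * gauss_lagrangian x (f x) (f' x)"
        using ub[OF x] x \<epsilon> sq(2)[OF x] by (intro L Y Pm) auto
      ultimately show "R' x \<le> gauss_lagrangian x (f x + u x) (f' x + u' x)
          + gauss_lagrangian x (f x - u x) (f' x - u' x) - 2 * gauss_lagrangian x (f x) (f' x)"
        by linarith
    qed
    moreover have "0 < \<eta>\<^sup>2 * c * (32 / 21 * \<epsilon> ^ 7)" using \<eta> cC \<epsilon> by simp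
    ultimately show "2 * J < Jp + Jm" using Rval by linarith
  qed (use \<epsilon> du in \<open>auto simp: u_def u'_def\<close>)
qed

section \<open>Convex competitors\<close>

lemma strict_mono_derivative_above_tangent:
  fixes h h' :: "real \<Rightarrow> real"
  assumes "is_interval J" "x \<in> J" "y \<in> J" "x \<noteq> y"
    and der: "\<And>x. x \<in> J \<Longrightarrow> (h has_real_derivative h' x) (at x)"
    and mono: "strict_mono_on J h'"
  shows "h x + h' x * (y - x) < h y"
proof (cases "x < y")
  case True
  have sub: "z \<in> J" if "x \<le> z" "z \<le> y" for z
    using mem_is_interval_1_I[OF assms(1-3) that] .
  obtain z where z: "x < z" "z < y" "h y - h x = (y - x) * h' z"
    using MVT2[OF True, of h h'] der sub by auto
  have "h' x < h' z" using strict_mono_onD[OF mono assms(2) sub[of z] z(1)] z by simp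
  then have "(y - x) * h' x < (y - x) * h' z" using True by simp
  with z(3) show ?thesis by (simp add: algebra_simps)
next
  case False
  then have yx: "y < x" using assms by simp
  have sub: "z \<in> J" if "y \<le> z" "z \<le> x" for z
    using mem_is_interval_1_I[OF assms(1,3,2) that] .
  obtain z where z: "y < z" "z < x" "h x - h y = (x - y) * h' z"
    using MVT2[OF yx, of h h'] der sub by auto
  have "h' z < h' x" using strict_mono_onD[OF mono sub[of z] assms(2) z(2)] z by simp
  then have "(x - y) * h' z < (x - y) * h' x" using yx by simp
  with z(3) show ?thesis by (simp add: algebra_simps)
qed

text \<open>A half-plane containing \<open>A\<close> contains its hull, so a supported point cannot
  become interior. The frontier of the competitor thus never has to be determined exactly.\<close>

lemma supported_subset_frontier_convex_hull:
  fixes A :: "'a::euclidean_space set"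
  assumes "\<And>p. p \<in> A \<Longrightarrow> \<exists>v. v \<noteq> 0 \<and> (\<forall>z\<in>A. v \<bullet> p \<le> v \<bullet> z)"
  shows "A \<subseteq> frontier (convex hull A)"
proof
  fix p assume p: "p \<in> A"
  then obtain v where v: "v \<noteq> 0" "\<forall>z\<in>A. v \<bullet> p \<le> v \<bullet> z" using assms by blast
  have "convex hull A \<subseteq> {z. v \<bullet> z \<ge> v \<bullet> p}"
    by (rule hull_minimal) (use v in \<open>auto intro: convex_halfspace_ge\<close>)
  then have "interior (convex hull A) \<subseteq> interior {z. v \<bullet> z \<ge> v \<bullet> p}" by (rule interior_mono)
  also have "\<dots> = {z. v \<bullet> z > v \<bullet> p}" using v(1) by (rule interior_halfspace_ge)
  finally have "p \<notin> interior (convex hull A)" by auto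
  moreover have "p \<in> closure (convex hull A)" using p by (meson closure_subset hull_inc subsetD)
  ultimately show "p \<in> frontier (convex hull A)" by (simp add: frontier_def)
qed

text \<open>No orientation is fixed: negating or exchanging the vectors gives another frame, which
  is how signs are normalised later.\<close>

locale plane_frame =
  fixes e n :: "real^2"
  assumes norm_e: "norm e = 1" and norm_n: "norm n = 1" and orth: "e \<bullet> n = 0"
begin

definition pt :: "real \<Rightarrow> real \<Rightarrow> real^2" where "pt x y = x *\<^sub>R e + y *\<^sub>R n"

lemma inner_pt: "v \<bullet> pt x y = x * (v \<bullet> e) + y * (v \<bullet> n)"
  by (simp add: pt_def inner_add_right)

lemma pt_inner_e [simp]: "pt x y \<bullet> e = x"
  using norm_e orth by (simp add: pt_def inner_add_left inner_commute[of n e] norm_eq_1)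

lemma pt_inner_n [simp]: "pt x y \<bullet> n = y"
  using norm_n orth by (simp add: pt_def inner_add_left norm_eq_1)

lemma pt_eq_iff [simp]: "pt x y = pt x' y' \<longleftrightarrow> x = x' \<and> y = y'"
  by (metis pt_inner_e pt_inner_n)

lemma pt_coords: "pt (z \<bullet> e) (z \<bullet> n) = z"
proof -
  have "e $ 1 * e $ 1 + e $ 2 * e $ 2 = 1" "n $ 1 * n $ 1 + n $ 2 * n $ 2 = 1"
    "e $ 1 * n $ 1 + e $ 2 * n $ 2 = 0"
    using norm_e norm_n orth by (simp_all add: norm_eq_1 inner_vec_def sum_2)
  then have "(z $ 1 * e $ 1 + z $ 2 * e $ 2) * e $ 1 + (z $ 1 * n $ 1 + z $ 2 * n $ 2) * n $ 1 = z $ 1"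
    "(z $ 1 * e $ 1 + z $ 2 * e $ 2) * e $ 2 + (z $ 1 * n $ 1 + z $ 2 * n $ 2) * n $ 2 = z $ 2"
    by algebra+
  then show ?thesis by (simp add: vec_eq_iff forall_2 pt_def inner_vec_def sum_2)
qed

lemma inner_coords: "v \<bullet> z = (z \<bullet> e) * (v \<bullet> e) + (z \<bullet> n) * (v \<bullet> n)"
  by (metis inner_pt pt_coords)

lemma norm_pt_squared: "(norm (pt x y))\<^sup>2 = x\<^sup>2 + y\<^sup>2"
  unfolding power2_norm_eq_inner inner_pt by (simp add: power2_eq_square)

lemma eq_0_iff: "v = 0 \<longleftrightarrow> v \<bullet> e = 0 \<and> v \<bullet> n = 0"
  by (metis pt_coords inner_zero_left)

end

text \<open>The graph lies in the frontier, but further frontier points over the same interval are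
  allowed, such as the opposite side of \<open>K\<close>.\<close>

locale convex_graph_frontier = plane_frame e n for e n :: "real^2" +
  fixes K :: "(real^2) set" and f f' :: "real \<Rightarrow> real" and \<alpha> \<beta> :: real
  assumes convex_K: "convex K"
    and f: "\<And>x. x \<in> {\<alpha><..<\<beta>} \<Longrightarrow> (f has_real_derivative f' x) (at x)"
    and f'_mono: "strict_mono_on {\<alpha><..<\<beta>} f'"
    and graph: "\<And>x. x \<in> {\<alpha><..<\<beta>} \<Longrightarrow> pt x (f x) \<in> frontier K"
begin

lemma graph_closure: "x \<in> {\<alpha><..<\<beta>} \<Longrightarrow> pt x (f x) \<in> closure K"
  using graph by (auto simp: frontier_def)

text \<open>A supporting functional restricted to the graph has a minimum at \<open>x\<close>, so
  the supporting line is the tangent. A second graph point, strictly above that tangent, decides on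
  which side \<open>K\<close> lies.\<close>

lemma closure_above_tangent:
  assumes x: "x \<in> {\<alpha><..<\<beta>}" and z: "z \<in> closure K"
  shows "f x + f' x * (z \<bullet> e - x) \<le> z \<bullet> n"
proof -
  obtain v where v: "v \<noteq> 0" "\<And>y. y \<in> closure K \<Longrightarrow> v \<bullet> pt x (f x) \<le> v \<bullet> y"
    using supporting_hyperplane_frontier[OF convex_K graph[OF x]] by metis
  let ?\<phi> = "\<lambda>y. y * (v \<bullet> e) + f y * (v \<bullet> n)"
  have min: "?\<phi> x \<le> ?\<phi> y" if "y \<in> {\<alpha><..<\<beta>}" for y
    using v(2)[OF graph_closure[OF that]] by (simp add: inner_pt)
  define d where "d = min (x - \<alpha>) (\<beta> - x)"
  have d: "d > 0" "\<And>y. \<bar>x - y\<bar> < d \<Longrightarrow> y \<in> {\<alpha><..<\<beta>}" using x by (auto simp: d_def)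
  have "(?\<phi> has_real_derivative (v \<bullet> e + f' x * (v \<bullet> n))) (at x)"
    using f[OF x] by (auto intro!: derivative_eq_intros)
  then have crit: "v \<bullet> e + f' x * (v \<bullet> n) = 0"
    using d min by (elim DERIV_local_min) auto
  have vn: "v \<bullet> n \<noteq> 0"
    using crit v(1) by (auto simp: eq_0_iff)
  have v2: "v \<bullet> n > 0"
  proof -
    obtain y where y: "y \<in> {\<alpha><..<\<beta>}" "y \<noteq> x"
      using d(1) d(2)[of "x + d / 2"] by force
    have t: "f x + f' x * (y - x) < f y"
      using y x by (intro strict_mono_derivative_above_tangent[OF _ _ _ _ f f'_mono]) (auto intro: is_interval_oo)
    have "0 \<le> (f y - (f x + f' x * (y - x))) * (v \<bullet> n)"
    proof -
      have "(f y - (f x + f' x * (y - x))) * (v \<bullet> n)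
          = ?\<phi> y - ?\<phi> x - (y - x) * (v \<bullet> e + f' x * (v \<bullet> n))"
        by (simp add: algebra_simps)
      then show ?thesis using min[OF y(1)] crit by simp
    qed
    with t vn show ?thesis by (simp add: zero_le_mult_iff)
  qed
  have "0 \<le> (v \<bullet> n) * (z \<bullet> n - (f x + f' x * (z \<bullet> e - x)))"
  proof -
    have "v \<bullet> z - v \<bullet> pt x (f x) = (v \<bullet> n) * (z \<bullet> n - (f x + f' x * (z \<bullet> e - x)))
        + (v \<bullet> e + f' x * (v \<bullet> n)) * (z \<bullet> e - x)"
      unfolding inner_coords[of v z] inner_pt by (simp add: algebra_simps)
    then show ?thesis using v(2)[OF z] crit by simp
  qed
  then show ?thesis using v2 by (simp add: zero_le_mult_iff)
qed

text \<open>A point below the chord and off the graph would lie inside the triangle of three graph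
  points. In terms of a supporting \<open>v\<close>, the graph point below \<open>z\<close> forces
  \<open>v \<bullet> n \<le> 0\<close>, the chord above it forces the reverse, and then the two ends
  force \<open>v = 0\<close>.\<close>

lemma frontier_above_chord:
  assumes ab: "\<alpha> < a" "b < \<beta>" and z: "z \<in> frontier K" "z \<notin> (\<lambda>x. pt x (f x)) ` {a..b}"
    and ze: "a < z \<bullet> e" "z \<bullet> e < b"
  shows "(b - z \<bullet> e) * f a + (z \<bullet> e - a) * f b \<le> (b - a) * (z \<bullet> n)"
proof (rule ccontr)
  assume "\<not> ?thesis"
  then have below: "(b - a) * (z \<bullet> n) < (b - z \<bullet> e) * f a + (z \<bullet> e - a) * f b" by simp
  obtain v where v: "v \<noteq> 0" "\<And>y. y \<in> closure K \<Longrightarrow> v \<bullet> z \<le> v \<bullet> y"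
    using supporting_hyperplane_frontier[OF convex_K z(1)] by metis
  let ?s = "z \<bullet> e" and ?t = "z \<bullet> n" and ?v1 = "v \<bullet> e" and ?v2 = "v \<bullet> n"
  have s: "?s \<in> {\<alpha><..<\<beta>}" "a \<in> {\<alpha><..<\<beta>}" "b \<in> {\<alpha><..<\<beta>}" using ab ze by auto
  have ineq: "?s * ?v1 + ?t * ?v2 \<le> x * ?v1 + f x * ?v2" if "x \<in> {\<alpha><..<\<beta>}" for x
    using v(2)[OF graph_closure[OF that]] unfolding inner_coords[of v z] inner_pt by simp
  have "f ?s \<le> ?t"
    using closure_above_tangent[OF s(1), of z] z by (simp add: frontier_def)
  moreover have "f ?s \<noteq> ?t"
  proof
    assume "f ?s = ?t"
    then have "z = pt ?s (f ?s)" using pt_coords[of z] by simp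
    moreover have "?s \<in> {a..b}" using ze by simp
    ultimately show False using z(2) by blast
  qed
  ultimately have "f ?s < ?t" by simp
  moreover have "(?t - f ?s) * ?v2 \<le> 0" using ineq[OF s(1)] by (simp add: algebra_simps)
  ultimately have "?v2 \<le> 0" by (simp add: mult_le_0_iff)
  moreover have "0 \<le> ((b - ?s) * f a + (?s - a) * f b - (b - a) * ?t) * ?v2"
  proof -
    have "(b - ?s) * (?s * ?v1 + ?t * ?v2) + (?s - a) * (?s * ?v1 + ?t * ?v2)
        \<le> (b - ?s) * (a * ?v1 + f a * ?v2) + (?s - a) * (b * ?v1 + f b * ?v2)"
      using mult_left_mono[OF ineq[OF s(2)], of "b - ?s"] mult_left_mono[OF ineq[OF s(3)], of "?s - a"] ze
      by linarith
    then show ?thesis by (simp add: algebra_simps)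
  qed
  ultimately have v2: "?v2 = 0" using below by (simp add: zero_le_mult_iff)
  have "0 \<le> (a - ?s) * ?v1" "0 \<le> (b - ?s) * ?v1"
    using ineq[OF s(2)] ineq[OF s(3)] v2 by (simp_all add: algebra_simps)
  then have "?v1 = 0" using ze by (auto simp: zero_le_mult_iff)
  with v2 v(1) show False by (simp add: eq_0_iff)
qed

text \<open>Every point of \<open>A\<close> is shown to have a supporting line: on the new arc the
  tangent of \<open>g\<close>, elsewhere the line that already supported \<open>K\<close>. The graph
  of \<open>g\<close> is enclosed between its end tangents, shared with \<open>f\<close>, and the
  chord; both arguments use only this enclosure and the convexity of \<open>g\<close>.\<close>

lemma competitor:
  fixes g g' :: "real \<Rightarrow> real"
  assumes ab: "\<alpha> < a" "a < b" "b < \<beta>"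
    and g: "\<And>x. x \<in> {a..b} \<Longrightarrow> (g has_real_derivative g' x) (at x)"
    and g'_mono: "strict_mono_on {a..b} g'"
    and ends: "g a = f a" "g b = f b" "g' a = f' a" "g' b = f' b"
  defines "A \<equiv> (frontier K - (\<lambda>x. pt x (f x)) ` {a..b}) \<union> (\<lambda>x. pt x (g x)) ` {a..b}"
  shows "A \<subseteq> frontier (convex hull A)"
    and "(frontier K - (\<lambda>x. pt x (f x)) ` {a..b}) \<inter> (\<lambda>x. pt x (g x)) ` {a..b} = {}"
proof -
  have in\<alpha>\<beta>: "x \<in> {\<alpha><..<\<beta>}" if "x \<in> {a..b}" for x using that ab by auto
  have gt: "g x + g' x * (y - x) \<le> g y" if "x \<in> {a..b}" "y \<in> {a..b}" for x y
    using strict_mono_derivative_above_tangent[OF _ that _ g g'_mono]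
    by (cases "x = y") (auto intro: less_imp_le is_interval_cc)
  have chord: "(b - a) * g x \<le> (b - x) * f a + (x - a) * f b" if "x \<in> {a..b}" for x
  proof -
    have "(b - x) * (g x + g' x * (a - x)) + (x - a) * (g x + g' x * (b - x))
        \<le> (b - x) * g a + (x - a) * g b"
      using that ab by (intro add_mono mult_left_mono gt) auto
    then show ?thesis by (simp add: ends algebra_simps)
  qed
  have chord_strict: "(b - a) * g x < (b - x) * f a + (x - a) * f b" if "a < x" "x < b" for x
  proof -
    have "(b - x) * (g x + g' x * (a - x)) + (x - a) * (g x + g' x * (b - x))
        < (b - x) * g a + (x - a) * g b"
      using that ab
      by (intro add_strict_mono mult_strict_left_mono
           strict_mono_derivative_above_tangent[OF _ _ _ _ g g'_mono]) (auto intro: is_interval_cc)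
    then show ?thesis by (simp add: ends algebra_simps)
  qed
  \<comment> \<open>Over the open interval the new arc is strictly below the chord and the remaining
    frontier is not; the two end points belong to the removed arc.\<close>
  show disj: "(frontier K - (\<lambda>x. pt x (f x)) ` {a..b}) \<inter> (\<lambda>x. pt x (g x)) ` {a..b} = {}"
  proof (intro equals0I, elim IntE DiffE imageE)
    fix z x assume z: "z \<in> frontier K" "z \<notin> (\<lambda>x. pt x (f x)) ` {a..b}" and x: "z = pt x (g x)" "x \<in> {a..b}"
    have "x \<noteq> a" "x \<noteq> b" using z x ab by (auto simp: ends)
    then show False
      using frontier_above_chord[OF ab(1,3) z] chord_strict[of x] x by auto
  qed
  have g_tangent: "g x + g' x * (z \<bullet> e - x) \<le> z \<bullet> n"
    if x: "x \<in> {a..b}" and z: "z \<in> frontier K" "z \<notin> (\<lambda>x. pt x (f x)) ` {a..b}" for x z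
  proof -
    have zc: "z \<in> closure K" using z by (simp add: frontier_def)
    have g'le: "g' a \<le> g' x" "g' x \<le> g' b"
      using x ab strict_mono_on_leD[OF g'_mono] by auto
    \<comment> \<open>Beyond an end, monotonicity of \<open>g'\<close> puts the tangent at
      \<open>x\<close> below the end tangent, which bounds \<open>K\<close> from below. Over the
      interval, \<open>z\<close> is above the chord and the chord above \<open>g\<close>.\<close>
    consider "z \<bullet> e \<le> a" | "b \<le> z \<bullet> e" | "a < z \<bullet> e" "z \<bullet> e < b" by linarith
    then show ?thesis
    proof cases
      case 1
      have "g x + g' x * (a - x) \<le> f a" using gt[OF x, of a] ab by (simp add: ends)
      moreover have "g' x * (z \<bullet> e - a) \<le> f' a * (z \<bullet> e - a)"
        using 1 g'le by (intro mult_right_mono_neg) (auto simp: ends)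
      moreover have "f a + f' a * (z \<bullet> e - a) \<le> z \<bullet> n"
        using closure_above_tangent[OF in\<alpha>\<beta>[of a] zc] ab by simp
      ultimately show ?thesis by (simp add: algebra_simps)
    next
      case 2
      have "g x + g' x * (b - x) \<le> f b" using gt[OF x, of b] ab by (simp add: ends)
      moreover have "g' x * (z \<bullet> e - b) \<le> f' b * (z \<bullet> e - b)"
        using 2 g'le by (intro mult_right_mono) (auto simp: ends)
      moreover have "f b + f' b * (z \<bullet> e - b) \<le> z \<bullet> n"
        using closure_above_tangent[OF in\<alpha>\<beta>[of b] zc] ab by simp
      ultimately show ?thesis by (simp add: algebra_simps)
    next
      case 3
      have "(b - a) * g (z \<bullet> e) \<le> (b - a) * (z \<bullet> n)"
        using frontier_above_chord[OF ab(1,3) z 3] chord[of "z \<bullet> e"] 3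
        by (meson atLeastAtMost_iff less_imp_le order_trans)
      then have "g (z \<bullet> e) \<le> z \<bullet> n" using ab by (meson diff_gt_0_iff_gt mult_le_cancel_left_pos)
      then show ?thesis using gt[OF x, of "z \<bullet> e"] 3 by simp
    qed
  qed
  have f_support: "v \<bullet> q \<le> v \<bullet> pt x (g x)"
    if x: "x \<in> {a..b}" and q: "q \<in> frontier K" "q \<notin> (\<lambda>x. pt x (f x)) ` {a..b}"
      and v: "\<And>y. y \<in> closure K \<Longrightarrow> v \<bullet> q \<le> v \<bullet> y" for x q v
  proof -
    let ?s = "q \<bullet> e" and ?t = "q \<bullet> n" and ?v1 = "v \<bullet> e" and ?v2 = "v \<bullet> n"
    have qc: "q \<in> closure K" using q by (simp add: frontier_def)
    have ineq: "v \<bullet> q \<le> y * ?v1 + f y * ?v2" if "y \<in> {\<alpha><..<\<beta>}" for y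
      using v[OF graph_closure[OF that]] by (simp add: inner_pt)
    have ba: "0 < b - a" using ab by simp
    show ?thesis
    \<comment> \<open>For \<open>?v2 \<le> 0\<close> the new arc is compared with the chord above
      it, whose ends lie in \<open>closure K\<close>; for \<open>?v2 > 0\<close>, with an end
      tangent below it.\<close>
    proof (cases "?v2 \<le> 0")
      case True
      have "(b - a) * (v \<bullet> q) = (b - x) * (v \<bullet> q) + (x - a) * (v \<bullet> q)" by (simp add: algebra_simps)
      also have "\<dots> \<le> (b - x) * (a * ?v1 + f a * ?v2) + (x - a) * (b * ?v1 + f b * ?v2)"
        using x ab by (intro add_mono mult_left_mono ineq) auto
      also have "\<dots> = (b - a) * (x * ?v1) + ((b - x) * f a + (x - a) * f b) * ?v2"
        by (simp add: algebra_simps)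
      also have "\<dots> \<le> (b - a) * (x * ?v1) + ((b - a) * g x) * ?v2"
        using True chord[OF x] by (intro add_left_mono mult_right_mono_neg) auto
      also have "\<dots> = (b - a) * (v \<bullet> pt x (g x))" by (simp add: inner_pt algebra_simps)
      finally show ?thesis using ba by simp
    next
      case False
      then have v2: "?v2 > 0" by simp
      have key: "v \<bullet> q \<le> v \<bullet> pt x (g x)"
        if c: "c \<in> {a..b}" "g c = f c" "g' c = f' c" and sgn: "(?v1 + ?v2 * f' c) * (x - c) \<ge> 0" for c
      proof -
        have "v \<bullet> q \<le> c * ?v1 + f c * ?v2" using ineq[OF in\<alpha>\<beta>[OF c(1)]] .
        also have "\<dots> \<le> c * ?v1 + f c * ?v2 + (?v1 + ?v2 * f' c) * (x - c)" using sgn by simp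
        also have "\<dots> = x * ?v1 + (f c + f' c * (x - c)) * ?v2" by (simp add: algebra_simps)
        also have "\<dots> \<le> x * ?v1 + g x * ?v2"
          using gt[OF c(1) x] v2 c by (intro add_left_mono mult_right_mono) auto
        finally show ?thesis by (simp add: inner_pt)
      qed
      \<comment> \<open>\<open>q\<close> lies above the tangent at \<open>c\<close> and minimises
        \<open>v\<close>, so \<open>v\<close> does not increase along this tangent from
        \<open>c\<close> towards \<open>q\<close>.\<close>
      have slope: "(?v1 + ?v2 * f' c) * (c - ?s) \<ge> 0" if c: "c \<in> {a..b}" for c
      proof -
        have "(f c + f' c * (?s - c)) * ?v2 \<le> ?t * ?v2"
          using closure_above_tangent[OF in\<alpha>\<beta>[OF c] qc] v2 by (intro mult_right_mono) auto
        moreover have "?s * ?v1 + ?t * ?v2 \<le> c * ?v1 + f c * ?v2"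
          using ineq[OF in\<alpha>\<beta>[OF c]] unfolding inner_coords[of v q] .
        ultimately show ?thesis by (simp add: algebra_simps)
      qed
      consider "?s < a" | "b < ?s" | "?s \<in> {a..b}" by force
      then show ?thesis
      proof cases
        case 1
        then have "?v1 + ?v2 * f' a \<ge> 0" using slope[of a] ab by (simp add: zero_le_mult_iff)
        then show ?thesis using x ab by (intro key[of a]) (auto simp: ends)
      next
        case 2
        then have "?v1 + ?v2 * f' b \<le> 0" using slope[of b] ab by (simp add: zero_le_mult_iff)
        then show ?thesis using x ab by (intro key[of b]) (auto simp: ends mult_nonpos_nonpos)
      next
        case 3
        \<comment> \<open>This case is contradictory: the graph point straight below
          \<open>q\<close> would have a smaller value of \<open>v\<close>.\<close>
        have "f ?s \<le> ?t" using closure_above_tangent[OF in\<alpha>\<beta>[OF 3] qc] by simp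
        moreover have "f ?s \<noteq> ?t" 
        proof
          assume "f ?s = ?t"
          then have "q = pt ?s (f ?s)" using pt_coords[of q] by simp
          with q(2) 3 show False by blast
        qed
        ultimately have "f ?s * ?v2 < ?t * ?v2" using v2 by simp
        moreover have "?s * ?v1 + ?t * ?v2 \<le> ?s * ?v1 + f ?s * ?v2"
          using ineq[OF in\<alpha>\<beta>[OF 3]] unfolding inner_coords[of v q] .
        ultimately show ?thesis by simp
      qed
    qed
  qed
  show "A \<subseteq> frontier (convex hull A)"
  proof (rule supported_subset_frontier_convex_hull)
    fix p assume "p \<in> A"
    then consider x where "x \<in> {a..b}" "p = pt x (g x)"
      | "p \<in> frontier K" "p \<notin> (\<lambda>x. pt x (f x)) ` {a..b}" by (auto simp: A_def)
    then show "\<exists>v. v \<noteq> 0 \<and> (\<forall>z\<in>A. v \<bullet> p \<le> v \<bullet> z)"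
    proof cases
      case 1
      define v where "v = pt (- g' x) 1"
      have ve: "v \<bullet> e = - g' x" "v \<bullet> n = 1" by (simp_all add: v_def)
      have "v \<bullet> p \<le> v \<bullet> z" if "z \<in> A" for z
      proof -
        have "g x + g' x * (z \<bullet> e - x) \<le> z \<bullet> n"
          using that g_tangent[OF 1(1)] gt[OF 1(1)] by (auto simp: A_def)
        then show ?thesis
          unfolding inner_coords[of v z] 1(2) inner_pt by (simp add: ve algebra_simps)
      qed
      moreover have "v \<noteq> 0" using ve by auto
      ultimately show ?thesis by blast
    next
      case 2
      obtain v where v: "v \<noteq> 0" "\<And>y. y \<in> closure K \<Longrightarrow> v \<bullet> p \<le> v \<bullet> y"
        using supporting_hyperplane_frontier[OF convex_K 2(1)] by metis
      have "v \<bullet> p \<le> v \<bullet> z" if "z \<in> A" for z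
        using that v(2) f_support[OF _ 2 v(2)] by (auto simp: A_def frontier_def)
      with v(1) show ?thesis by blast
    qed
  qed
qed

end

section \<open>Comparing the Gaussian lengths of boundary arcs\<close>

context plane_frame begin

lemma gauss_h1_graph:
  fixes g g' :: "real \<Rightarrow> real"
  assumes "a \<le> b" and g: "\<And>x. x \<in> {a..b} \<Longrightarrow> (g has_real_derivative g' x) (at x)"
    and g': "continuous_on {a..b} g'"
  shows "emeasure gauss_h1 ((\<lambda>x. pt x (g x)) ` {a..b}) < \<infinity>"
    and "((\<lambda>x. gauss_lagrangian x (g x) (g' x)) has_integral
          measure gauss_h1 ((\<lambda>x. pt x (g x)) ` {a..b})) {a..b}"
    and "compact ((\<lambda>x. pt x (g x)) ` {a..b})"
proof -
  let ?w = "\<lambda>x :: real^2. exp (- (norm x)\<^sup>2 / 2)"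
  have w: "continuous_on UNIV ?w" by (intro continuous_intros) auto
  have inj: "inj_on (\<lambda>x. pt x (g x)) {a..b}" by (auto intro: inj_onI)
  have der: "((\<lambda>x. pt x (g x)) has_vector_derivative pt 1 (g' x)) (at x within {a..b})"
    if "x \<in> {a..b}" for x
    unfolding pt_def
    by (rule has_vector_derivative_at_within)
      (auto intro!: derivative_eq_intros g[OF that] simp flip: has_real_derivative_iff_has_vector_derivative)
  have cont: "continuous_on {a..b} (\<lambda>x. pt 1 (g' x))"
    unfolding pt_def by (intro continuous_intros g')
  note arc = arc_weighted_hausdorff1[of ?w, OF w _ \<open>a \<le> b\<close> inj der cont, folded gauss_h1_def]
  show "emeasure gauss_h1 ((\<lambda>x. pt x (g x)) ` {a..b}) < \<infinity>" by (rule arc(1)) auto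
  have "?w (pt x (g x)) * norm (pt 1 (g' x)) = gauss_lagrangian x (g x) (g' x)" for x
  proof -
    have "norm (pt 1 (g' x)) = sqrt (1 + (g' x)\<^sup>2)"
      using norm_pt_squared[of 1 "g' x"] by (simp add: real_sqrt_unique)
    then show ?thesis by (simp add: norm_pt_squared gauss_lagrangian_def)
  qed
  with arc(2) show "((\<lambda>x. gauss_lagrangian x (g x) (g' x)) has_integral
          measure gauss_h1 ((\<lambda>x. pt x (g x)) ` {a..b})) {a..b}" by simp
  show "compact ((\<lambda>x. pt x (g x)) ` {a..b})"
    using continuous_on_vector_derivative[OF der] by (intro compact_continuous_image) auto
qed

end

context convex_graph_frontier begin

text \<open>Both frontiers contain \<open>R\<close>, whose Gaussian measure is finite, so global
  maximality can be reduced to the exchanged arcs by cancelling \<open>R\<close>.\<close>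

lemma maximizer_arc_le:
  fixes g g' :: "real \<Rightarrow> real"
  assumes max: "\<And>D. convex D \<Longrightarrow> gauss_perimeter D \<le> gauss_perimeter K"
    and ab: "\<alpha> < a" "a < b" "b < \<beta>"
    and f': "continuous_on {a..b} f'"
    and g: "\<And>x. x \<in> {a..b} \<Longrightarrow> (g has_real_derivative g' x) (at x)"
    and g': "continuous_on {a..b} g'"
    and g'_mono: "strict_mono_on {a..b} g'"
    and ends: "g a = f a" "g b = f b" "g' a = f' a" "g' b = f' b"
  shows "measure gauss_h1 ((\<lambda>x. pt x (g x)) ` {a..b}) \<le> measure gauss_h1 ((\<lambda>x. pt x (f x)) ` {a..b})"
proof -
  let ?F = "(\<lambda>x. pt x (f x)) ` {a..b}" and ?G = "(\<lambda>x. pt x (g x)) ` {a..b}"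
  define R where "R = frontier K - ?F"
  have F: "emeasure gauss_h1 ?F < \<infinity>" "compact ?F"
    using gauss_h1_graph(1,3)[OF less_imp_le[OF ab(2)] f f'] ab by auto
  have G: "emeasure gauss_h1 ?G < \<infinity>" "compact ?G"
    using gauss_h1_graph(1,3)[OF less_imp_le[OF ab(2)] g g'] by auto
  have Fm: "?F \<in> sets gauss_h1" and Gm: "?G \<in> sets gauss_h1"
    using F(2) G(2) by (auto intro: borel_closed compact_imp_closed)
  have Rm: "R \<in> sets gauss_h1"
    using Fm by (auto simp: R_def intro: borel_closed)
  have "?F \<subseteq> frontier K" using graph ab by auto
  then have frK: "frontier K = R \<union> ?F" by (auto simp: R_def)
  define D where "D = convex hull (R \<union> ?G)"
  have sub: "R \<union> ?G \<subseteq> frontier D" and disj: "R \<inter> ?G = {}"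
    using competitor[OF ab g g'_mono ends] by (auto simp: D_def R_def)
  have "emeasure gauss_h1 R + emeasure gauss_h1 ?G = emeasure gauss_h1 (R \<union> ?G)"
    using Rm Gm disj by (rule plus_emeasure)
  also have "\<dots> \<le> emeasure gauss_h1 (frontier D)"
    using sub by (intro emeasure_mono) (auto intro: borel_closed)
  also have "\<dots> \<le> emeasure gauss_h1 (frontier K)"
  proof -
    have "ennreal (1 / (2 * pi)) * emeasure gauss_h1 (frontier D)
        \<le> ennreal (1 / (2 * pi)) * emeasure gauss_h1 (frontier K)"
      using max[of D] unfolding gauss_perimeter_eq D_def by (simp only: convex_convex_hull)
    moreover have "ennreal (1 / (2 * pi)) \<noteq> 0" "ennreal (1 / (2 * pi)) \<noteq> top" by simp_all
    ultimately show ?thesis by (metis ennreal_mult_le_mult_iff)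
  qed
  also have "\<dots> = emeasure gauss_h1 R + emeasure gauss_h1 ?F"
    unfolding frK using Rm Fm by (intro plus_emeasure[symmetric]) (auto simp: R_def)
  finally have le: "emeasure gauss_h1 R + emeasure gauss_h1 ?G \<le> emeasure gauss_h1 R + emeasure gauss_h1 ?F" .
  have "emeasure gauss_h1 R \<le> emeasure gauss_h1 (frontier K)"
    by (intro emeasure_mono) (auto simp: R_def intro: borel_closed)
  then have "emeasure gauss_h1 R \<noteq> \<infinity>"
    using gauss_h1_frontier_convex_finite[OF convex_K] by (auto simp: top_unique)
  with le have "emeasure gauss_h1 ?G \<le> emeasure gauss_h1 ?F"
    by (simp add: ennreal_add_left_cancel_le)
  then show ?thesis using F(1) unfolding measure_def by (intro enn2real_mono) auto
qed

end

text \<open>Maximality bounds the arcs for \<open>\<sigma> = 1\<close> and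
  \<open>\<sigma> = - 1\<close> separately, while their sum is too large. Adding the two cancels the
  first variation, so no Euler-Lagrange equation is involved.\<close>

lemma (in plane_frame) maximizer_no_strictly_convex_graph:
  fixes f f' f'' :: "real \<Rightarrow> real"
  assumes "convex K" and max: "\<And>D. convex D \<Longrightarrow> gauss_perimeter D \<le> gauss_perimeter K"
    and "r > 0" "m > 0"
    and df: "\<And>x. \<bar>x - x0\<bar> < r \<Longrightarrow> (f has_real_derivative f' x) (at x)"
    and df': "\<And>x. \<bar>x - x0\<bar> < r \<Longrightarrow> (f' has_real_derivative f'' x) (at x)"
    and f'': "\<And>x. \<bar>x - x0\<bar> < r \<Longrightarrow> m \<le> f'' x"
    and graph: "\<And>x. \<bar>x - x0\<bar> < r \<Longrightarrow> pt x (f x) \<in> frontier K"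
  shows False
proof -
  have inr: "\<bar>x - x0\<bar> < r" if "x \<in> {x0 - r<..<x0 + r}" for x using that by auto
  have mono: "strict_mono_on {x0 - r<..<x0 + r} f'"
  proof (rule strict_mono_onI)
    fix s t assume st: "s \<in> {x0 - r<..<x0 + r}" "t \<in> {x0 - r<..<x0 + r}" "s < t"
    show "f' s < f' t"
    proof (rule DERIV_pos_imp_increasing[OF st(3)])
      fix x assume "s \<le> x" "x \<le> t"
      then have "\<bar>x - x0\<bar> < r" using st by auto
      then show "\<exists>y. (f' has_real_derivative y) (at x) \<and> 0 < y"
        using df' f'' \<open>m > 0\<close> by (meson less_le_trans)
    qed
  qed
  interpret convex_graph_frontier e n K f f' "x0 - r" "x0 + r"
    using assms(1,3) df graph inr mono by unfold_locales auto
  obtain \<epsilon> u u' where \<epsilon>: "0 < \<epsilon>" "\<epsilon> < r" and du: "\<And>x. (u has_real_derivative u' x) (at x)"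
    and cu': "continuous_on UNIV u'"
    and ends: "u (x0 - \<epsilon>) = 0" "u (x0 + \<epsilon>) = 0" "u' (x0 - \<epsilon>) = 0" "u' (x0 + \<epsilon>) = 0"
    and smono: "\<And>\<sigma>. \<bar>\<sigma>\<bar> \<le> 1 \<Longrightarrow> strict_mono_on {x0 - \<epsilon>..x0 + \<epsilon>} (\<lambda>x. f' x + \<sigma> * u' x)"
    and J: "\<And>Jp Jm J. \<lbrakk>((\<lambda>x. gauss_lagrangian x (f x) (f' x)) has_integral J) {x0 - \<epsilon>..x0 + \<epsilon>};
       ((\<lambda>x. gauss_lagrangian x (f x + u x) (f' x + u' x)) has_integral Jp) {x0 - \<epsilon>..x0 + \<epsilon>};
       ((\<lambda>x. gauss_lagrangian x (f x - u x) (f' x - u' x)) has_integral Jm) {x0 - \<epsilon>..x0 + \<epsilon>}\<rbrakk>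
      \<Longrightarrow> 2 * J < Jp + Jm"
    by (rule convex_graph_perturbation[OF \<open>r > 0\<close> \<open>m > 0\<close> df df' f'']) (assumption | rule that)+
  let ?I = "{x0 - \<epsilon>..x0 + \<epsilon>}"
  have inI: "\<bar>x - x0\<bar> < r" if "x \<in> ?I" for x using that \<epsilon> by auto
  have cf': "continuous_on ?I f'"
    by (rule DERIV_continuous_on[OF has_field_derivative_at_within[OF df'[OF inI]]])
  have ab: "x0 - r < x0 - \<epsilon>" "x0 - \<epsilon> < x0 + \<epsilon>" "x0 + \<epsilon> < x0 + r" using \<epsilon> by auto
  have dg: "((\<lambda>x. f x + \<sigma> * u x) has_real_derivative f' x + \<sigma> * u' x) (at x)" if "x \<in> ?I" for x \<sigma>
    by (intro DERIV_add DERIV_cmult du df inI that)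
  have cg: "continuous_on ?I (\<lambda>x. f' x + \<sigma> * u' x)" for \<sigma>
    by (intro continuous_intros cf' continuous_on_subset[OF cu']) auto
  have le: "measure gauss_h1 ((\<lambda>x. pt x (f x + \<sigma> * u x)) ` ?I) \<le> measure gauss_h1 ((\<lambda>x. pt x (f x)) ` ?I)"
    if "\<bar>\<sigma>\<bar> \<le> 1" for \<sigma>
    by (rule maximizer_arc_le[OF max ab cf' dg cg smono[OF that]]) (simp_all add: ends)
  have int: "((\<lambda>x. gauss_lagrangian x (f x + \<sigma> * u x) (f' x + \<sigma> * u' x)) has_integral
      measure gauss_h1 ((\<lambda>x. pt x (f x + \<sigma> * u x)) ` ?I)) ?I" for \<sigma>
    using ab by (intro gauss_h1_graph(2) dg cg) auto
  show False
    using J[OF int[of 0, simplified] int[of 1, simplified] int[of "- 1", simplified]]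
      le[of 1] le[of "- 1"] by simp
qed

section \<open>Curvature of the boundary of a maximizer\<close>

lemma curve_coordinate_derivative:
  assumes "(\<gamma> has_vector_derivative v) (at t)"
  shows "((\<lambda>t. \<gamma> t \<bullet> b) has_real_derivative v \<bullet> b) (at t)"
  using bounded_linear.has_vector_derivative[OF bounded_linear_inner_left assms]
  by (simp add: has_real_derivative_iff_has_vector_derivative)

context plane_frame begin

text \<open>For velocity \<open>v\<close> and acceleration \<open>w\<close> this is the signed
  curvature times \<open>norm v ^ 3\<close>, up to the orientation of the frame.\<close>

definition frame_det :: "real^2 \<Rightarrow> real^2 \<Rightarrow> real" where
  "frame_det v w = (v \<bullet> e) * (w \<bullet> n) - (v \<bullet> n) * (w \<bullet> e)"

text \<open>Since \<open>\<gamma>' t0 \<bullet> e > 0\<close>, the first coordinate can be inverted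
  near \<open>t0\<close> and the curve becomes a graph over \<open>e\<close>, to which the
  variational argument applies.\<close>

lemma maximizer_no_positive_curvature:
  fixes \<gamma> \<gamma>' \<gamma>'' :: "real \<Rightarrow> real^2"
  assumes K: "convex K" and max: "\<And>D. convex D \<Longrightarrow> gauss_perimeter D \<le> gauss_perimeter K"
    and I: "open I" "t0 \<in> I"
    and \<gamma>: "\<And>t. t \<in> I \<Longrightarrow> (\<gamma> has_vector_derivative \<gamma>' t) (at t)"
    and \<gamma>': "\<And>t. t \<in> I \<Longrightarrow> (\<gamma>' has_vector_derivative \<gamma>'' t) (at t)"
    and \<gamma>'': "continuous_on I \<gamma>''"
    and fr: "\<And>t. t \<in> I \<Longrightarrow> \<gamma> t \<in> frontier K"
    and pos: "\<gamma>' t0 \<bullet> e > 0" "frame_det (\<gamma>' t0) (\<gamma>'' t0) > 0"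
  shows False
proof -
  define x where "x t = \<gamma> t \<bullet> e" for t
  define y where "y t = \<gamma> t \<bullet> n" for t
  define dx where "dx t = \<gamma>' t \<bullet> e" for t
  define dy where "dy t = \<gamma>' t \<bullet> n" for t
  define ddx where "ddx t = \<gamma>'' t \<bullet> e" for t
  define ddy where "ddy t = \<gamma>'' t \<bullet> n" for t
  \<comment> \<open>In terms of the graph function \<open>f\<close>, \<open>q\<close> is the second derivative \<open>f''\<close>.\<close>
  define q where "q t = (ddy t * dx t - dy t * ddx t) / (dx t) ^ 3" for t
  have der: "(x has_real_derivative dx t) (at t)" "(y has_real_derivative dy t) (at t)"
    "(dx has_real_derivative ddx t) (at t)" "(dy has_real_derivative ddy t) (at t)" if "t \<in> I" for t
    unfolding x_def y_def dx_def dy_def ddx_def ddy_def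
    by (intro curve_coordinate_derivative \<gamma> \<gamma>' that)+
  have "isCont \<gamma>'' t0" using \<gamma>'' I by (simp add: continuous_on_eq_continuous_at)
  then have dd: "isCont ddx t0" "isCont ddy t0" unfolding ddx_def ddy_def by (intro continuous_intros; assumption)+
  have d1: "isCont dx t0" "isCont dy t0" using der(3,4)[OF I(2)] by (auto intro: DERIV_isCont)
  have dx0: "dx t0 > 0" using pos by (simp add: dx_def)
  have q0: "q t0 > 0"
    using pos dx0 by (simp add: q_def frame_det_def dx_def dy_def ddx_def ddy_def algebra_simps)
  have cq: "isCont q t0" unfolding q_def using dx0 by (intro continuous_intros d1 dd) auto
  \<comment> \<open>Continuity of \<open>\<gamma>''\<close> spreads the positive curvature at
    \<open>t0\<close> to a uniform lower bound nearby, the constant \<open>m\<close> of the graph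
    argument.\<close>
  have "\<forall>\<^sub>F t in nhds t0. t \<in> I \<and> dx t > 0 \<and> q t > q t0 / 2"
  proof (intro eventually_conj)
    show "\<forall>\<^sub>F t in nhds t0. t \<in> I" by (rule eventually_nhds_in_open[OF I])
    show "\<forall>\<^sub>F t in nhds t0. dx t > 0"
      using d1(1) dx0 unfolding isCont_def tendsto_at_iff_tendsto_nhds by (rule order_tendstoD)
    show "\<forall>\<^sub>F t in nhds t0. q t > q t0 / 2"
      using cq q0 unfolding isCont_def tendsto_at_iff_tendsto_nhds by (intro order_tendstoD) auto
  qed
  then obtain d0 where d0: "d0 > 0" "\<And>t. dist t t0 < d0 \<Longrightarrow> t \<in> I \<and> dx t > 0 \<and> q t > q t0 / 2"
    unfolding eventually_nhds_metric by blast
  define d where "d = d0 / 2"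
  let ?T = "{t0 - d..t0 + d}"
  have d: "d > 0" "\<And>t. t \<in> ?T \<Longrightarrow> t \<in> I \<and> dx t > 0 \<and> q t > q t0 / 2"
    using d0 by (auto simp: d_def dist_real_def)
  have xmono: "x s < x t" if "s \<in> ?T" "t \<in> ?T" "s < t" for s t
  proof (rule DERIV_pos_imp_increasing[OF that(3)])
    fix z assume "s \<le> z" "z \<le> t"
    then have "z \<in> ?T" using that by auto
    then show "\<exists>y. (x has_real_derivative y) (at z) \<and> 0 < y" using der(1) d(2) by blast
  qed
  have inj: "inj_on x ?T"
    by (rule inj_onI) (metis xmono less_irrefl linorder_neqE)
  define \<tau> where "\<tau> = the_inv_into ?T x"
  have \<tau>: "\<tau> (x t) = t" if "t \<in> ?T" for t
    unfolding \<tau>_def by (rule the_inv_into_f_f[OF inj that])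
  have contx: "continuous_on ?T x"
    by (rule DERIV_continuous_on[OF has_field_derivative_at_within[OF der(1)]]) (use d in blast)
  \<comment> \<open>The distance from \<open>x t0\<close> to the nearer end of the image of
    \<open>?T\<close>, so every abscissa within \<open>r\<close> is attained inside
    \<open>?T\<close>.\<close>
  define r where "r = min (x (t0 + d) - x t0) (x t0 - x (t0 - d))"
  have r: "r > 0" using xmono[of "t0 - d" t0] xmono[of t0 "t0 + d"] d(1) by (simp add: r_def)
  have inv: "\<exists>t. t0 - d < t \<and> t < t0 + d \<and> x t = s" if sr: "\<bar>s - x t0\<bar> < r" for s
  proof -
    have s: "x (t0 - d) < s" "s < x (t0 + d)" using sr by (auto simp: r_def)
    then obtain t where "t0 - d \<le> t" "t \<le> t0 + d" "x t = s"
      using IVT'[of x "t0 - d" s "t0 + d"] contx d(1) by auto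
    with s show ?thesis by (metis less_eq_real_def less_irrefl)
  qed
  define f where "f s = y (\<tau> s)" for s
  define f' where "f' s = dy (\<tau> s) / dx (\<tau> s)" for s
  define f'' where "f'' s = q (\<tau> s)" for s
  have *: "(\<tau> has_real_derivative inverse (dx (\<tau> s))) (at s)" "\<tau> s \<in> ?T" "x (\<tau> s) = s"
    if sr: "\<bar>s - x t0\<bar> < r" for s
  proof -
    obtain t where t: "t0 - d < t" "t < t0 + d" "x t = s" using inv[OF sr] by blast
    then have tT: "t \<in> ?T" by simp
    have "(\<tau> has_real_derivative inverse (dx t)) (at (x t))"
      unfolding has_field_derivative_def
    proof (rule has_derivative_inverse_strong[where S = "{t0 - d<..<t0 + d}" and f = x
          and x = t and f' = "(*) (dx t)"])
      show "(x has_derivative (*) (dx t)) (at t)"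
        using der(1) d(2)[OF tT] by (simp add: has_field_derivative_def)
      show "continuous_on {t0 - d<..<t0 + d} x" by (rule continuous_on_subset[OF contx]) auto
      show "(*) (dx t) \<circ> (*) (inverse (dx t)) = id" using d(2)[OF tT] by (auto simp: fun_eq_iff)
    qed (use t \<tau> in auto)
    with t \<tau>[OF tT] tT show "(\<tau> has_real_derivative inverse (dx (\<tau> s))) (at s)" "\<tau> s \<in> ?T" "x (\<tau> s) = s"
      by auto
  qed
  show False
  proof (rule maximizer_no_strictly_convex_graph[OF K max r half_gt_zero[OF q0]])
    fix s assume s: "\<bar>s - x t0\<bar> < r"
    note \<tau>s = *[OF s] and T = d(2)[OF *(2)[OF s]]
    show "(f has_real_derivative f' s) (at s)"
      unfolding f_def f'_def divide_inverse using T by (intro DERIV_chain2[OF der(2) \<tau>s(1)]) auto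
    have "((\<lambda>t. dy t / dx t) has_real_derivative
        (ddy (\<tau> s) * dx (\<tau> s) - dy (\<tau> s) * ddx (\<tau> s)) / (dx (\<tau> s) * dx (\<tau> s))) (at (\<tau> s))"
      using T by (intro DERIV_divide der) auto
    from DERIV_chain2[OF this \<tau>s(1)]
    show "(f' has_real_derivative f'' s) (at s)"
      using T by (simp add: f'_def[abs_def] f''_def q_def power3_eq_cube field_simps)
    show "q t0 / 2 \<le> f'' s" using T by (simp add: f''_def)
    have "pt s (f s) = \<gamma> (\<tau> s)"
      using pt_coords[of "\<gamma> (\<tau> s)"] \<tau>s(3) by (simp add: f_def x_def y_def)
    then show "pt s (f s) \<in> frontier K" using fr T by simp
  qed
qed

end

text \<open>Negating \<open>n\<close> changes the sign of the determinant, and negating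
  \<open>e\<close> makes the tangential component positive. If that component is 0, a nonzero
  determinant forces a nonzero component along \<open>n\<close>, and the vectors are
  exchanged.\<close>

lemma maximizer_no_curvature:
  fixes \<gamma> \<gamma>' \<gamma>'' :: "real \<Rightarrow> real^2"
  assumes "plane_frame e n"
    and K: "convex K" and max: "\<And>D. convex D \<Longrightarrow> gauss_perimeter D \<le> gauss_perimeter K"
    and I: "open I" "t \<in> I"
    and \<gamma>: "\<And>t. t \<in> I \<Longrightarrow> (\<gamma> has_vector_derivative \<gamma>' t) (at t)"
    and \<gamma>': "\<And>t. t \<in> I \<Longrightarrow> (\<gamma>' has_vector_derivative \<gamma>'' t) (at t)"
    and \<gamma>'': "continuous_on I \<gamma>''"
    and fr: "\<And>t. t \<in> I \<Longrightarrow> \<gamma> t \<in> frontier K"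
  shows "(\<gamma>' t \<bullet> e) * (\<gamma>'' t \<bullet> n) - (\<gamma>' t \<bullet> n) * (\<gamma>'' t \<bullet> e) = 0"
proof (rule ccontr)
  assume ne: "\<not> ?thesis"
  have no: False if "plane_frame a b" "\<gamma>' t \<bullet> a > 0"
    "(\<gamma>' t \<bullet> a) * (\<gamma>'' t \<bullet> b) - (\<gamma>' t \<bullet> b) * (\<gamma>'' t \<bullet> a) > 0" for a b
    using plane_frame.maximizer_no_positive_curvature[OF that(1) K max I \<gamma> \<gamma>' \<gamma>'' fr that(2)] that(3)
    by (simp add: plane_frame.frame_det_def[OF that(1)])
  have no': False if "plane_frame a b" "\<gamma>' t \<bullet> a > 0"
    "(\<gamma>' t \<bullet> a) * (\<gamma>'' t \<bullet> b) - (\<gamma>' t \<bullet> b) * (\<gamma>'' t \<bullet> a) \<noteq> 0" for a b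
  proof -
    have "plane_frame a (- b)" using that(1) by (simp add: plane_frame_def)
    from no[OF this] no[OF that(1)] that show False by (auto simp: neq_iff)
  qed
  have no'': False if "plane_frame a b" "\<gamma>' t \<bullet> a \<noteq> 0"
    "(\<gamma>' t \<bullet> a) * (\<gamma>'' t \<bullet> b) - (\<gamma>' t \<bullet> b) * (\<gamma>'' t \<bullet> a) \<noteq> 0" for a b
  proof -
    have "plane_frame (- a) b" using that(1) by (simp add: plane_frame_def)
    from no'[OF this] no'[OF that(1)] that show False by (auto simp: neq_iff)
  qed
  have "plane_frame n e" using assms(1) by (simp add: plane_frame_def inner_commute)
  with no''[OF assms(1)] no''[OF this] ne show False by (cases "\<gamma>' t \<bullet> e = 0") auto
qed

lemma plane_frame_of_vector:
  fixes v :: "real^2"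
  assumes "v \<noteq> 0"
  obtains e n where "plane_frame e n" "v \<bullet> e > 0" "v \<bullet> n = 0"
proof
  define w :: "real^2" where "w = vector [- v $ 2, v $ 1]"
  have nw: "norm w = norm v"
  proof (rule power2_eq_imp_eq)
    show "(norm w)\<^sup>2 = (norm v)\<^sup>2" by (simp add: norm_real2_squared w_def)
  qed auto
  have vw: "v \<bullet> w = 0" by (simp add: w_def inner_vec_def sum_2)
  have "norm v > 0" using assms by simp
  then show "plane_frame (v /\<^sub>R norm v) (w /\<^sub>R norm v)"
    by (simp add: plane_frame_def nw vw)
  show "v \<bullet> (v /\<^sub>R norm v) > 0" "v \<bullet> (w /\<^sub>R norm v) = 0"
    using assms by (simp_all add: vw)
qed

section \<open>From zero curvature to a segment\<close>

context plane_frame begin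

text \<open>The parametrisation is not by arc length, so \<open>\<gamma>''\<close> is only parallel
  to \<open>\<gamma>'\<close> and need not vanish. Normalising the tangent removes its change of
  speed and replaces a uniqueness argument for the linear equation satisfied by
  \<open>\<gamma>' \<bullet> n\<close>.\<close>

lemma straight_curve:
  fixes \<gamma> \<gamma>' \<gamma>'' :: "real \<Rightarrow> real^2"
  assumes I: "is_interval I" "t0 \<in> I" "open I"
    and \<gamma>: "\<And>t. t \<in> I \<Longrightarrow> (\<gamma> has_vector_derivative \<gamma>' t) (at t)"
    and \<gamma>': "\<And>t. t \<in> I \<Longrightarrow> (\<gamma>' has_vector_derivative \<gamma>'' t) (at t)"
    and nz: "\<And>t. t \<in> I \<Longrightarrow> \<gamma>' t \<noteq> 0"
    and det: "\<And>t. t \<in> I \<Longrightarrow> (\<gamma>' t \<bullet> e) * (\<gamma>'' t \<bullet> n) - (\<gamma>' t \<bullet> n) * (\<gamma>'' t \<bullet> e) = 0"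
    and start: "\<gamma>' t0 \<bullet> n = 0" and t: "t \<in> I"
  shows "\<gamma> t \<bullet> n = \<gamma> t0 \<bullet> n"
proof -
  define k where "k t = \<gamma>' t \<bullet> e" for t
  define h where "h t = \<gamma>' t \<bullet> n" for t
  have const: "g t = g t0" if "\<And>t. t \<in> I \<Longrightarrow> (g has_real_derivative 0) (at t)" "t \<in> I" for g :: "real \<Rightarrow> real" and t
  proof -
    have "convex I" using I(1) by (simp add: is_interval_convex)
    then have "\<exists>c. \<forall>x\<in>I. g x = c"
      by (rule has_field_derivative_zero_constant[OF _ has_field_derivative_at_within[OF that(1)]])
    then show ?thesis using that(2) I(2) by metis
  qed
  have sq: "(k t)\<^sup>2 + (h t)\<^sup>2 > 0" if "t \<in> I" for t
  proof -
    have "pt (k t) (h t) = \<gamma>' t" by (simp add: k_def h_def pt_coords)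
    then have "(k t)\<^sup>2 + (h t)\<^sup>2 = (norm (\<gamma>' t))\<^sup>2"
      using norm_pt_squared[of "k t" "h t"] by simp
    then show ?thesis using nz[OF that] by simp
  qed
  \<comment> \<open>The sine of the angle between \<open>\<gamma>'\<close> and \<open>e\<close> is constant.\<close>
  have "((\<lambda>t. h t / sqrt ((k t)\<^sup>2 + (h t)\<^sup>2)) has_real_derivative 0) (at t)" if "t \<in> I" for t
  proof -
    let ?s = "sqrt ((k t)\<^sup>2 + (h t)\<^sup>2)"
    have dk: "(k has_real_derivative \<gamma>'' t \<bullet> e) (at t)" and dh: "(h has_real_derivative \<gamma>'' t \<bullet> n) (at t)"
      unfolding k_def h_def by (intro curve_coordinate_derivative \<gamma>' that)+
    have s: "?s > 0" "?s * ?s = (k t)\<^sup>2 + (h t)\<^sup>2" using sq[OF that] by auto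
    have "((\<lambda>t. sqrt ((k t)\<^sup>2 + (h t)\<^sup>2)) has_real_derivative
        (k t * (\<gamma>'' t \<bullet> e) + h t * (\<gamma>'' t \<bullet> n)) / ?s) (at t)"
    proof -
      have "((\<lambda>t. (k t)\<^sup>2 + (h t)\<^sup>2) has_real_derivative
          2 * (k t * (\<gamma>'' t \<bullet> e) + h t * (\<gamma>'' t \<bullet> n))) (at t)"
        by (rule derivative_eq_intros dk dh refl)+ (simp add: algebra_simps)
      from DERIV_chain2[where f = sqrt and g = "\<lambda>t. (k t)\<^sup>2 + (h t)\<^sup>2", OF DERIV_real_sqrt[OF sq[OF that]] this]
      show ?thesis by (rule DERIV_cong) (simp add: inverse_eq_divide del: distrib_left_numeral)
    qed
    moreover have "?s \<noteq> 0" using s(1) by (rule less_imp_neq[symmetric])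
    ultimately have "((\<lambda>t. h t / sqrt ((k t)\<^sup>2 + (h t)\<^sup>2)) has_real_derivative
        ((\<gamma>'' t \<bullet> n) * ?s - h t * ((k t * (\<gamma>'' t \<bullet> e) + h t * (\<gamma>'' t \<bullet> n)) / ?s)) / (?s * ?s)) (at t)"
      by (rule DERIV_divide[OF dh])
    moreover have "(\<gamma>'' t \<bullet> n) * ?s - h t * ((k t * (\<gamma>'' t \<bullet> e) + h t * (\<gamma>'' t \<bullet> n)) / ?s) = 0"
    proof -
      have clear: "A * s - B * (C / s) = (A * (s * s) - B * C) / s" if "s > 0" for A B C s :: real
        using that by (simp add: field_simps)
      have "(\<gamma>'' t \<bullet> n) * (?s * ?s) - h t * (k t * (\<gamma>'' t \<bullet> e) + h t * (\<gamma>'' t \<bullet> n))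
          = k t * (k t * (\<gamma>'' t \<bullet> n) - h t * (\<gamma>'' t \<bullet> e))"
        unfolding s(2) by (simp add: power2_eq_square algebra_simps)
      also have "\<dots> = 0" using det[OF that] by (simp add: k_def h_def)
      finally show ?thesis unfolding clear[OF s(1)] by simp
    qed
    ultimately show ?thesis by simp
  qed
  then have quot: "h t / sqrt ((k t)\<^sup>2 + (h t)\<^sup>2) = h t0 / sqrt ((k t0)\<^sup>2 + (h t0)\<^sup>2)" if "t \<in> I" for t
    using const that by blast
  have h0: "h t = 0" if "t \<in> I" for t
  proof -
    have "h t0 = 0" by (simp add: h_def start)
    then have "h t / sqrt ((k t)\<^sup>2 + (h t)\<^sup>2) = 0" using quot[OF that] by simp
    moreover have "sqrt ((k t)\<^sup>2 + (h t)\<^sup>2) \<noteq> 0"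
      using real_sqrt_gt_zero[OF sq[OF that]] by (rule less_imp_neq[symmetric])
    ultimately show ?thesis by (simp only: divide_eq_0_iff) simp
  qed
  show ?thesis
  proof (rule const[OF _ t])
    fix t assume "t \<in> I"
    then show "((\<lambda>t. \<gamma> t \<bullet> n) has_real_derivative 0) (at t)"
      using curve_coordinate_derivative[OF \<gamma>, of t n] h0 by (simp add: h_def)
  qed
qed

lemma line_eq_image: "(\<lambda>s. pt s c) ` E = (+) (c *\<^sub>R n) ` (\<lambda>s. s *\<^sub>R e) ` E"
  by (simp add: image_image pt_def add.commute)

lemma linear_scaleR_e: "linear (\<lambda>s. s *\<^sub>R e)"
  by (intro bounded_linear.linear bounded_linear_scaleR_left)

lemma connected_subset_line_convex:
  assumes "connected B" and line: "\<And>z. z \<in> B \<Longrightarrow> z \<bullet> n = c"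
  shows "convex B"
proof -
  define E where "E = (\<lambda>z. z \<bullet> e) ` B"
  have "connected E" unfolding E_def
    by (intro connected_continuous_image assms continuous_intros)
  then have "convex E" by (simp flip: is_interval_convex_1 is_interval_connected_1)
  moreover have "B = (\<lambda>s. pt s c) ` E"
  proof -
    have "pt (z \<bullet> e) c = z" if "z \<in> B" for z using line[OF that] pt_coords[of z] by simp
    then show ?thesis by (simp add: E_def image_image)
  qed
  ultimately show ?thesis
    unfolding line_eq_image by (simp add: convex_translation convex_linear_image linear_scaleR_e)
qed

lemma closed_segment_line:
  assumes "a \<le> b"
  shows "closed_segment (pt a c) (pt b c) = (\<lambda>s. pt s c) ` {a..b}"
proof -
  have "closed_segment (pt a c) (pt b c) = closed_segment (c *\<^sub>R n + a *\<^sub>R e) (c *\<^sub>R n + b *\<^sub>R e)"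
    by (simp add: pt_def add.commute)
  also have "\<dots> = (\<lambda>s. pt s c) ` closed_segment a b"
    unfolding line_eq_image closed_segment_translation
    by (simp only: closed_segment_linear_image[OF linear_scaleR_e])
  finally show ?thesis using assms by (simp add: closed_segment_eq_real_ivl)
qed

text \<open>The ends are the infimum and the supremum of the coordinate along the line. They may or
  may not belong to \<open>B\<close>, which is why \<open>B\<close> is caught between an open and a
  closed segment; two distinct points make it nondegenerate.\<close>

lemma convex_bounded_subset_line_segment:
  assumes "convex B" "bounded B" "p \<in> B" "p' \<in> B" "p \<noteq> p'" and line: "\<And>z. z \<in> B \<Longrightarrow> z \<bullet> n = c"
  shows "\<exists>a b. a \<noteq> b \<and> open_segment a b \<subseteq> B \<and> B \<subseteq> closed_segment a b"
proof -
  define E where "E = (\<lambda>z. z \<bullet> e) ` B"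
  have B: "z \<in> B \<longleftrightarrow> z \<bullet> n = c \<and> z \<bullet> e \<in> E" for z
  proof -
    have "z = z'" if "z \<bullet> n = c" "z' \<in> B" "z \<bullet> e = z' \<bullet> e" for z'
      using that line pt_coords by metis
    then show ?thesis using line by (auto simp: E_def)
  qed
  have cE: "is_interval E" unfolding is_interval_convex_1 E_def
    by (intro convex_linear_image assms bounded_linear.linear bounded_linear_inner_left)
  have bE: "bounded E" unfolding E_def
    by (intro bounded_linear_image assms bounded_linear_inner_left)
  then have bdd: "bdd_above E" "bdd_below E" by (auto intro: bounded_imp_bdd_above bounded_imp_bdd_below)
  have ne: "E \<noteq> {}" "p \<bullet> e \<in> E" "p' \<bullet> e \<in> E" using assms by (auto simp: E_def)
  have "p \<bullet> e \<noteq> p' \<bullet> e" using assms line pt_coords by metis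
  then have lt: "Inf E < Sup E"
    using cInf_lower[OF ne(2) bdd(2)] cInf_lower[OF ne(3) bdd(2)] cSup_upper[OF ne(2) bdd(1)]
      cSup_upper[OF ne(3) bdd(1)] by linarith
  have seg: "z \<in> closed_segment (pt (Inf E) c) (pt (Sup E) c) \<longleftrightarrow> z \<bullet> n = c \<and> z \<bullet> e \<in> {Inf E..Sup E}" for z
    unfolding closed_segment_line[OF less_imp_le[OF lt]] using pt_coords[of z]
    by (auto intro!: image_eqI[of _ _ "z \<bullet> e"])
  show ?thesis
  proof (intro exI conjI)
    show "pt (Inf E) c \<noteq> pt (Sup E) c" using lt by simp
    show "B \<subseteq> closed_segment (pt (Inf E) c) (pt (Sup E) c)"
      using seg B cInf_lower[OF _ bdd(2)] cSup_upper[OF _ bdd(1)] by auto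
    show "open_segment (pt (Inf E) c) (pt (Sup E) c) \<subseteq> B"
    proof
      fix z assume z: "z \<in> open_segment (pt (Inf E) c) (pt (Sup E) c)"
      then have zn: "z \<bullet> n = c" "Inf E \<le> z \<bullet> e" "z \<bullet> e \<le> Sup E" "z \<noteq> pt (Inf E) c" "z \<noteq> pt (Sup E) c"
        using seg[of z] by (auto simp: open_segment_def)
      then have "Inf E < z \<bullet> e" "z \<bullet> e < Sup E"
        using pt_coords[of z] by (metis less_eq_real_def)+
      then obtain s t where "s \<in> E" "s < z \<bullet> e" "t \<in> E" "z \<bullet> e < t"
        using cInf_lessD[OF ne(1)] less_cSupD[OF ne(1)] by metis
      then have "z \<bullet> e \<in> E" using cE by (meson less_imp_le mem_is_interval_1_I)
      then show "z \<in> B" using B zn by blast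
    qed
  qed
qed

end

theorem theorem1p1:
  fixes \<Omega> :: "(real^2) set" and P :: "real^2" and \<delta> :: real
  assumes "convex \<Omega>"
    and "\<forall>D :: (real^2) set. convex D \<longrightarrow> gauss_perimeter D \<le> gauss_perimeter \<Omega>"
    and "P \<in> frontier \<Omega>"
    and "\<delta> > 0"
    and "C2_curve (ball P (2 * \<delta>) \<inter> frontier \<Omega>)"
  shows "\<exists>a b. a \<noteq> b \<and> open_segment a b \<subseteq> ball P \<delta> \<inter> frontier \<Omega> \<and>
                ball P \<delta> \<inter> frontier \<Omega> \<subseteq> closed_segment a b"
proof -
  obtain I :: "real set" and \<gamma> \<gamma>' \<gamma>'' where I: "open I" "is_interval I" "I \<noteq> {}"
    and \<gamma>: "\<And>t. t \<in> I \<Longrightarrow> (\<gamma> has_vector_derivative \<gamma>' t) (at t)"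
    and \<gamma>': "\<And>t. t \<in> I \<Longrightarrow> (\<gamma>' has_vector_derivative \<gamma>'' t) (at t)"
    and \<gamma>'': "continuous_on I \<gamma>''" and nz: "\<And>t. t \<in> I \<Longrightarrow> \<gamma>' t \<noteq> 0"
    and img: "\<gamma> ` I = ball P (2 * \<delta>) \<inter> frontier \<Omega>"
    using assms(5) unfolding C2_curve_def by metis
  have "P \<in> \<gamma> ` I" using img assms(3,4) by simp
  then obtain t0 where t0: "t0 \<in> I" "\<gamma> t0 = P" by auto
  \<comment> \<open>The frame is aligned with the tangent at \<open>P\<close>, so the normal
    component of \<open>\<gamma>'\<close> starts at 0 and the whole curve stays on the line through
    \<open>P\<close> along \<open>e\<close>.\<close>
  obtain e n where fr: "plane_frame e n" and en: "\<gamma>' t0 \<bullet> e > 0" "\<gamma>' t0 \<bullet> n = 0"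
    using plane_frame_of_vector[OF nz[OF t0(1)]] by metis
  interpret plane_frame e n by (rule fr)
  have det: "(\<gamma>' t \<bullet> e) * (\<gamma>'' t \<bullet> n) - (\<gamma>' t \<bullet> n) * (\<gamma>'' t \<bullet> e) = 0" if "t \<in> I" for t
    by (rule maximizer_no_curvature[OF fr assms(1) _ I(1) that \<gamma> \<gamma>' \<gamma>'']) (use assms(2) img in auto)
  have line: "z \<bullet> n = P \<bullet> n" if "z \<in> \<gamma> ` I" for z
    using straight_curve[OF I(2) t0(1) I(1) \<gamma> \<gamma>' nz det en(2)] that t0(2) by auto
  let ?B = "ball P \<delta> \<inter> frontier \<Omega>"
  have B: "?B = ball P \<delta> \<inter> \<gamma> ` I" using img assms(4) by auto
  have cont: "continuous_on I \<gamma>"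
    using \<gamma> has_vector_derivative_at_within by (intro continuous_on_vector_derivative) blast
  \<comment> \<open>A connected subset of a line is convex, so the smaller disc meets the curve in a
    single piece.\<close>
  have "convex (\<gamma> ` I)"
    using line connected_continuous_image[OF cont] I(2)
    by (intro connected_subset_line_convex) (auto simp: is_interval_connected_1)
  then have "convex ?B" unfolding B by (intro convex_Int convex_ball)
  \<comment> \<open>The coordinate along \<open>e\<close> increases strictly at \<open>t0\<close>,
    which yields a second point in the disc and excludes a degenerate segment.\<close>
  moreover obtain t where "t \<in> I" "\<gamma> t \<in> ball P \<delta>" "\<gamma> t \<noteq> P"
  proof -
    obtain d1 where d1: "d1 > 0" "\<And>h. 0 < h \<Longrightarrow> h < d1 \<Longrightarrow> \<gamma> t0 \<bullet> e < \<gamma> (t0 + h) \<bullet> e"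
      using DERIV_pos_inc_right[OF curve_coordinate_derivative[OF \<gamma>[OF t0(1)]] en(1)] by blast
    obtain d2 where d2: "d2 > 0" "ball t0 d2 \<subseteq> I"
      using I(1) t0(1) open_contains_ball by blast
    obtain d3 where d3: "d3 > 0" "\<And>t. t \<in> I \<Longrightarrow> dist t t0 < d3 \<Longrightarrow> dist (\<gamma> t) P < \<delta>"
      using cont t0 assms(4) unfolding continuous_on_iff by metis
    define h where "h = min d1 (min d2 d3) / 2"
    have h: "0 < h" "h < d1" "h < d2" "h < d3" using d1 d2 d3 by (auto simp: h_def)
    have "t0 + h \<in> I" using h d2(2) by (auto simp: dist_real_def)
    moreover have "dist (\<gamma> (t0 + h)) P < \<delta>" using d3(2)[OF calculation] h by (simp add: dist_real_def)
    moreover have "\<gamma> (t0 + h) \<noteq> P" using d1(2)[of h] h t0(2) by auto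
    ultimately show thesis using that by (simp add: dist_commute)
  qed
  moreover have "bounded ?B" by (rule bounded_subset[OF bounded_ball]) auto
  moreover have "P \<in> ?B" using assms(3,4) by simp
  moreover have "\<gamma> t \<in> ?B" using \<open>t \<in> I\<close> \<open>\<gamma> t \<in> ball P \<delta>\<close> unfolding B by blast
  moreover have "z \<bullet> n = P \<bullet> n" if "z \<in> ?B" for z using that line unfolding B by blast
  ultimately show ?thesis
    using convex_bounded_subset_line_segment[of ?B P "\<gamma> t" "P \<bullet> n"] \<open>\<gamma> t \<noteq> P\<close> by blast
qed

end
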